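(* Let $n\geq 3$ and let $M(\mathcal{W}_n)$ be the graphic matroid of the wheel graph $\mathcal{W}_n$. Then the base-cobase graph $G(M(\mathcal{W}_n),M(\mathcal{W}_n)^\ast)$ is Hamiltonian connected, i.e. for any two distinct vertices $u,v$ it has a Hamiltonian path with endpoints $u$ and $v$.
   Context: The wheel graph $\mathcal{W}_n$ ($n\ge 3$) has vertices $c,v_1,\dots,v_n$, rim edges $v_iv_{i+1}$ (indices mod $n$) and spokes $cv_i$ for $i\in[n]$. For a matroid $M$ on $E$ with bases $\mathcal{B}$, a base-cobase is a base $B$ such that $E\setminus B$ is also a base; the base-cobase graph $G(M,M^\ast)$ has the base-cobases as vertices, two being adjacent iff their symmetric difference has exactly two elements. *)

theory Defs
  imports Main
begin

text \<open>A simple graph is a pair of a vertex set and a set of edges, each edge being a two-element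
  set of vertices.\<close>

type_synonym 'v sgraph = "'v set \<times> 'v set set"

definition verts :: "'v sgraph \<Rightarrow> 'v set" where
  "verts G = fst G"

definition edges :: "'v sgraph \<Rightarrow> 'v set set" where
  "edges G = snd G"

definition is_cycle :: "'v set set \<Rightarrow> 'v list \<Rightarrow> bool" where
  "is_cycle F vs \<longleftrightarrow> length vs \<ge> 3 \<and> distinct vs \<and>
     successively (\<lambda>x y. {x, y} \<in> F) vs \<and> {last vs, hd vs} \<in> F"

definition acyclic_edges :: "'v set set \<Rightarrow> bool" where
  "acyclic_edges F \<longleftrightarrow> (\<nexists>vs. is_cycle F vs)"

definition hamiltonian_path :: "'v sgraph \<Rightarrow> 'v \<Rightarrow> 'v \<Rightarrow> 'v list \<Rightarrow> bool" where
  "hamiltonian_path G u v p \<longleftrightarrow> p \<noteq> [] \<and> hd p = u \<and> last p = v \<and>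
     distinct p \<and> set p = verts G \<and> successively (\<lambda>x y. {x, y} \<in> edges G) p"

definition hamiltonian_connected :: "'v sgraph \<Rightarrow> bool" where
  "hamiltonian_connected G \<longleftrightarrow>
     (\<forall>u\<in>verts G. \<forall>v\<in>verts G. u \<noteq> v \<longrightarrow> (\<exists>p. hamiltonian_path G u v p))"

text \<open>A matroid is given by its ground set and its set of bases.\<close>

type_synonym 'e matroid = "'e set \<times> 'e set set"

definition ground :: "'e matroid \<Rightarrow> 'e set" where
  "ground M = fst M"

definition bases :: "'e matroid \<Rightarrow> 'e set set" where
  "bases M = snd M"

text \<open>The independent sets of the graphic matroid are the acyclic edge sets; its bases are the
  inclusion-maximal ones.\<close>

definition graphic_matroid :: "'v sgraph \<Rightarrow> 'v set matroid" where
  "graphic_matroid G =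
     (edges G,
      {B. B \<subseteq> edges G \<and> acyclic_edges B \<and>
          (\<forall>F. B \<subseteq> F \<and> F \<subseteq> edges G \<and> acyclic_edges F \<longrightarrow> F = B)})"

definition base_cobases :: "'e matroid \<Rightarrow> 'e set set" where
  "base_cobases M = {B \<in> bases M. ground M - B \<in> bases M}"

definition base_cobase_graph :: "'e matroid \<Rightarrow> 'e set sgraph" where
  "base_cobase_graph M =
     (base_cobases M,
      {{A, B} | A B. A \<in> base_cobases M \<and> B \<in> base_cobases M \<and> card (sym_diff A B) = 2})"

datatype wheel_vertex = Hub | Rim nat

text \<open>The rim vertices are indexed by \<open>0, \<dots>, n - 1\<close>, as representatives of the residues modulo
  \<open>n\<close>.\<close>

definition wheel_graph :: "nat \<Rightarrow> wheel_vertex sgraph" where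
  "wheel_graph n =
     (insert Hub (Rim ` {..<n}),
      {{Rim i, Rim (Suc i mod n)} | i. i < n} \<union> {{Hub, Rim i} | i. i < n})"

end

theory Submission
  imports Defs
begin

text \<open>A base-cobase of the wheel with rim edges \<open>x\<close> (a nonempty proper subset of the \<open>n\<close> indices) has
  as its spokes either the complement of \<open>x\<close> or the complement of \<open>x\<close> rotated by one. So the
  base-cobase graph consists of two copies of the \<open>n\<close>-cube without its two constant vertices, together
  with some edges between the copies at the cyclic intervals.

  Fix one coordinate. The vertices where it is 0 form two copies of the \<open>(n - 1)\<close>-cube without the zero
  vertex, the other vertices are their complements, and each half is Hamiltonian connected: this is
  proved by adding one coordinate at a time, which adds one cube to each copy. Cubes have
  Hamiltonian paths between any two vertices of different parity, and such a path is inserted as a detour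
  next to the vertex \<open>{0, 2}\<close>, which has no edge to the other copy. Finally a Hamiltonian path of
  one half is joined with, or interrupted by, one of the complementary half. The induction starts
  at the 3-cube, and \<open>n = 3\<close> itself is treated separately, both by explicit paths.\<close>

section \<open>Hamiltonian paths\<close>

text \<open>A relation in place of an edge set lets the same gluing lemmas serve codes, words and
  edge sets.\<close>

definition ham :: "('v \<Rightarrow> 'v \<Rightarrow> bool) \<Rightarrow> 'v set \<Rightarrow> 'v \<Rightarrow> 'v \<Rightarrow> bool" where
  "ham R V u v \<longleftrightarrow> (\<exists>p. p \<noteq> [] \<and> hd p = u \<and> last p = v \<and> distinct p \<and> set p = V \<and> successively R p)"

lemma ham_singleton: "ham R {v} v v"
  unfolding ham_def by (rule exI[of _ "[v]"]) simp

lemma ham_join: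
  assumes "ham R V u z" "ham R W w v" "R z w" "V \<inter> W = {}"
  shows "ham R (V \<union> W) u v"
proof -
  obtain p where p: "p \<noteq> []" "hd p = u" "last p = z" "distinct p" "set p = V" "successively R p"
    using assms(1) unfolding ham_def by blast
  obtain q where q: "q \<noteq> []" "hd q = w" "last q = v" "distinct q" "set q = W" "successively R q"
    using assms(2) unfolding ham_def by blast
  show ?thesis
    unfolding ham_def
    by (rule exI[of _ "p @ q"]) (use p q assms(3,4) in \<open>auto simp: successively_append_iff\<close>)
qed

lemma ham_rev:
  assumes "ham R V u v" "symp R"
  shows "ham R V v u"
proof -
  obtain p where p: "p \<noteq> []" "hd p = u" "last p = v" "distinct p" "set p = V" "successively R p"
    using assms(1) unfolding ham_def by blast
  have "successively R (rev p)"
    unfolding successively_rev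
    by (rule successively_mono[OF p(6)]) (use assms(2) in \<open>auto dest: sympD\<close>)
  then show ?thesis
    unfolding ham_def
    by (intro exI[of _ "rev p"]) (use p in \<open>auto simp: hd_rev last_rev\<close>)
qed

lemma ham_map:
  assumes "ham R V u v" "inj_on f V" "\<And>x y. x \<in> V \<Longrightarrow> y \<in> V \<Longrightarrow> R x y \<Longrightarrow> R' (f x) (f y)"
  shows "ham R' (f ` V) (f u) (f v)"
proof -
  obtain p where p: "p \<noteq> []" "hd p = u" "last p = v" "distinct p" "set p = V" "successively R p"
    using assms(1) unfolding ham_def by blast
  have "successively R' (map f p)"
    unfolding successively_map
    by (rule successively_mono[OF p(6)]) (use p(5) assms(3) in auto)
  then show ?thesis
    unfolding ham_def
    by (intro exI[of _ "map f p"]) (use p assms(2) in \<open>auto simp: hd_map last_map distinct_map\<close>)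
qed

lemma ham_mono:
  assumes "ham R V u v" "\<And>x y. x \<in> V \<Longrightarrow> y \<in> V \<Longrightarrow> R x y \<Longrightarrow> R' x y"
  shows "ham R' V u v"
  using ham_map[of R V u v id R'] assms by auto

text \<open>Replacing the edge from \<open>z\<close> to \<open>w\<close> by a walk through
  \<open>W\<close> keeps both endpoints, even if \<open>z\<close> or \<open>w\<close> is one of
  them.\<close>

lemma ham_detour:
  assumes p: "hd (ps @ z # w # qs) = u" "last (ps @ z # w # qs) = v"
      "distinct (ps @ z # w # qs)" "set (ps @ z # w # qs) = V" "successively R (ps @ z # w # qs)"
    and W: "ham R W z' w'" "R z z'" "R w' w" "V \<inter> W = {}"
  shows "ham R (V \<union> W) u v"
proof -
  obtain q where q: "q \<noteq> []" "hd q = z'" "last q = w'" "distinct q" "set q = W" "successively R q"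
    using W(1) unfolding ham_def by blast
  show ?thesis
    unfolding ham_def
    by (rule exI[of _ "ps @ z # q @ w # qs"])
      (use p q W(2-) in \<open>auto simp: successively_append_iff successively_Cons hd_append split: if_splits\<close>)
qed

text \<open>As \<open>u \<noteq> v\<close>, the path has an edge at \<open>c\<close>, but which one
  is unknown; hence the requirement on every neighbour \<open>d\<close> of \<open>c\<close>.\<close>

lemma ham_detour_at:
  assumes HP: "ham R V u v" "u \<noteq> v" and c: "c \<in> V" and sym: "symp R" and VW: "V \<inter> W = {}"
    and *: "\<And>d. d \<in> V \<Longrightarrow> R c d \<Longrightarrow> \<exists>c' d'. R c c' \<and> R d d' \<and> ham R W c' d'"
  shows "ham R (V \<union> W) u v"
proof -
  obtain p where p: "p \<noteq> []" "hd p = u" "last p = v" "distinct p" "set p = V" "successively R p"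
    using HP(1) unfolding ham_def by blast
  from c p(5) obtain as bs where ab: "p = as @ c # bs"
    by (metis in_set_conv_decomp)
  show ?thesis
  proof (cases bs)
    case (Cons d bs')
    with ab have pp: "p = as @ c # d # bs'" by simp
    have "R c d" "d \<in> V" using p(5,6) pp by (auto simp: successively_append_iff)
    with * obtain c' d' where "R c c'" "R d d'" "ham R W c' d'" by blast
    then show ?thesis
      using ham_detour[of as c d bs' u v V R W c' d'] p pp VW sym by (auto dest: sympD)
  next
    \<comment> \<open>Here \<open>c\<close> ends the path, so the edge runs from \<open>d\<close> to
      \<open>c\<close> and the walk through \<open>W\<close> is reversed.\<close>
    case Nil
    with ab p(2,3) HP(2) have "as \<noteq> []" by auto
    then obtain as' d where as: "as = as' @ [d]" by (metis rev_exhaust)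
    with ab Nil have pp: "p = as' @ d # c # []" by simp
    have "R d c" "d \<in> V" using p(5,6) pp by (auto simp: successively_append_iff)
    with * sym obtain c' d' where "R c c'" "R d d'" "ham R W c' d'" by (meson sympD)
    then show ?thesis
      using ham_detour[of as' d c "[]" u v V R W d' c'] p pp VW sym ham_rev[of R W c' d']
      by (auto dest: sympD)
  qed
qed

section \<open>Two shifted copies of the cube\<close>

text \<open>A pair \<open>(x, a)\<close> stands for the edge set of the wheel whose rim edges are those with index in \<open>x\<close>
  and whose missing spokes are those with index in \<open>shift f a x\<close>, where \<open>f\<close> is the rotation by one;
  the two summands in \<open>adj\<close> are the numbers of exchanged rim edges and of exchanged spokes.
  With \<open>f = Suc\<close> the relation does not depend on \<open>n\<close>, which makes the induction possible.\<close>

definition shift :: "(nat \<Rightarrow> nat) \<Rightarrow> bool \<Rightarrow> nat set \<Rightarrow> nat set" where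
  "shift f a x = (if a then f ` x else x)"

definition adj :: "(nat \<Rightarrow> nat) \<Rightarrow> nat set \<times> bool \<Rightarrow> nat set \<times> bool \<Rightarrow> bool" where
  "adj f u v \<longleftrightarrow> card (sym_diff (fst u) (fst v)) +
     card (sym_diff (shift f (snd u) (fst u)) (shift f (snd v) (fst v))) = 2"

lemma symp_adj: "symp (adj f)"
  by (rule sympI) (simp add: adj_def Un_commute)

lemma card_sym_diff_shift:
  assumes "inj_on f (x \<union> y)"
  shows "card (sym_diff (shift f a x) (shift f a y)) = card (sym_diff x y)"
proof -
  have "sym_diff (f ` x) (f ` y) = f ` sym_diff x y"
    using assms by (auto simp: inj_on_def)
  moreover have "inj_on f (sym_diff x y)"
    by (rule inj_on_subset[OF assms]) auto
  ultimately show ?thesis by (simp add: shift_def card_image)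
qed

text \<open>Within one copy both summands of \<open>adj\<close> count the same flips, so each copy
  carries the cube graph.\<close>

lemma adj_same_iff:
  assumes "inj_on f (x \<union> y)"
  shows "adj f (x, a) (y, a) \<longleftrightarrow> card (sym_diff x y) = 1"
  using card_sym_diff_shift[OF assms, of a] by (auto simp: adj_def)

lemma adj_insert:
  assumes "inj_on f (insert c x)" "c \<notin> x"
  shows "adj f (x, a) (insert c x, a)" "adj f (insert c x, a) (x, a)"
proof -
  have "sym_diff x (insert c x) = {c}" "sym_diff (insert c x) x = {c}" using assms by auto
  then show "adj f (x, a) (insert c x, a)" "adj f (insert c x, a) (x, a)"
    using assms by (auto simp: adj_same_iff insert_absorb)
qed

definition toggle :: "'a \<Rightarrow> 'a set \<Rightarrow> 'a set" where
  "toggle c x = (if c \<in> x then x - {c} else insert c x)"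

lemma adj_toggle: "inj_on f (insert c x) \<Longrightarrow> adj f (x, a) (toggle c x, a)"
  using adj_insert[of f c "x - {c}" a] adj_insert[of f c x a]
  by (auto simp: toggle_def insert_absorb)

section \<open>Parity and Hamiltonian paths of a single cube\<close>

lemma even_card_sym_diff:
  assumes "finite x" "finite y"
  shows "even (card (sym_diff x y)) \<longleftrightarrow> (even (card x) \<longleftrightarrow> even (card y))"
proof -
  have "card x = card (x - y) + card (x \<inter> y)" "card y = card (y - x) + card (x \<inter> y)"
    using assms by (metis card_Un_disjoint Int_Diff_disjoint Un_Diff_Int finite_Diff finite_Int Un_commute Int_commute)+
  moreover have "card (sym_diff x y) = card (x - y) + card (y - x)"
    using assms by (intro card_Un_disjoint) auto
  ultimately show ?thesis by auto
qed

lemma even_card_toggle: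
  assumes "finite x"
  shows "even (card (toggle c x)) \<longleftrightarrow> odd (card x)"
proof -
  have "sym_diff x (toggle c x) = {c}" by (auto simp: toggle_def)
  then show ?thesis
    using even_card_sym_diff[of x "toggle c x"] assms by (auto simp: toggle_def)
qed

text \<open>The interval \<open>{A..B}\<close> is a cube of dimension \<open>card (B - A)\<close>,
  and its two facets at an index \<open>c\<close> are again intervals. An index where
  \<open>x\<close> and \<open>y\<close> differ puts them into opposite facets, which are traversed
  one after the other by induction.\<close>

lemma ham_cube:
  assumes "finite B" "inj f" "x \<in> {A..B}" "y \<in> {A..B}" "even (card x) \<noteq> even (card y)"
  shows "ham (adj f) ({A..B} \<times> {a}) (x, a) (y, a)"
  using assms
proof (induction "card (B - A)" arbitrary: A B x y rule: less_induct)
  case less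
  then have "x \<noteq> y" by auto
  then obtain c where c: "c \<in> x \<longleftrightarrow> c \<notin> y" by blast
  note fin = finite_subset[OF _ \<open>finite B\<close>]
  have inj: "inj_on f z" for z using \<open>inj f\<close> inj_on_subset by blast
  define P where "P d = {z \<in> {A..B}. c \<in> z \<longleftrightarrow> d}" for d
  from c less.prems have cAB: "c \<in> B" "c \<notin> A" by auto
  have P1: "P True = {insert c A..B}" "P False = {A..B - {c}}"
    using cAB by (auto simp: P_def)
  have IH: "ham (adj f) (P d \<times> {a}) (z, a) (w, a)"
    if "z \<in> P d" "w \<in> P d" "even (card z) \<noteq> even (card w)" for d z w
  proof -
    have "card (B - insert c A) < card (B - A)" "card (B - {c} - A) < card (B - A)"
      by (rule psubset_card_mono; use cAB \<open>finite B\<close> in auto)+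
    then show ?thesis
      using that less.hyps[of B "insert c A" z w] less.hyps[of "B - {c}" A z w] \<open>finite B\<close> \<open>inj f\<close>
      by (cases d) (auto simp: P1)
  qed
  have PU: "{A..B} = P (c \<in> x) \<union> P (c \<in> y)" and PI: "P (c \<in> x) \<inter> P (c \<in> y) = {}"
    using c by (auto simp: P_def)
  have finx: "finite x" using less.prems fin by auto
  show ?case
  proof (cases "B - A = {c}")
    \<comment> \<open>The cube is a single edge and both facets are points.\<close>
    case True
    have "y = toggle c x" using c True less.prems(3,4) by (auto simp: toggle_def)
    have "P (c \<in> x) = {x}" "P (c \<in> y) = {y}"
      using True less.prems(3,4) c cAB unfolding P_def by auto
    then show ?thesis
      using ham_join[of "adj f" "{(x, a)}" "(x, a)" "(x, a)" "{(y, a)}" "(y, a)" "(y, a)"] PU PI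
        ham_singleton[of "adj f"] adj_toggle[OF inj] \<open>y = toggle c x\<close> by auto
  next
    case False
    then obtain i where i: "i \<in> B" "i \<notin> A" "i \<noteq> c" using cAB by auto
    \<comment> \<open>The crossing: \<open>z\<close> stays in the facet of \<open>x\<close> with the
      other parity, and \<open>w\<close> lies opposite to it with the parity of \<open>x\<close>,
      hence not that of \<open>y\<close>.\<close>
    define z where "z = toggle i x"
    define w where "w = toggle c z"
    have z: "z \<in> P (c \<in> x)" and w: "w \<in> P (c \<in> y)"
      using i c cAB less.prems(3) by (auto simp: P_def z_def w_def toggle_def)
    have par: "even (card z) \<longleftrightarrow> odd (card x)" "even (card w) \<longleftrightarrow> odd (card z)"
      using even_card_toggle[of x i] even_card_toggle[of z c] finx
      by (auto simp: z_def w_def toggle_def)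
    have xy: "x \<in> P (c \<in> x)" "y \<in> P (c \<in> y)" using less.prems by (auto simp: P_def)
    have "ham (adj f) (P (c \<in> x) \<times> {a} \<union> P (c \<in> y) \<times> {a}) (x, a) (y, a)"
      by (rule ham_join[of _ _ _ "(z, a)" _ "(w, a)"])
        (use IH xy z w par less.prems(5) PI adj_toggle[OF inj] in \<open>auto simp: w_def\<close>)
    then show ?thesis using PU by (simp add: Sigma_Un_distrib1)
  qed
qed

section \<open>The rotation of the rim and the two vertex sets\<close>

definition rot :: "nat \<Rightarrow> nat \<Rightarrow> nat" where
  "rot n i = Suc i mod n"

lemma inj_on_rot: "inj_on (rot n) {..<n}"
  by (auto simp: inj_on_def rot_def mod_Suc split: if_splits)

lemma rot_image: "rot n ` {..<n} = {..<n}"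
  by (rule endo_inj_surj) (auto simp: rot_def inj_on_rot)

lemma rot_image_diff:
  assumes "x \<subseteq> {..<n}"
  shows "rot n ` ({..<n} - x) = {..<n} - rot n ` x"
  using inj_on_image_set_diff[OF inj_on_rot[of n], of "{..<n}" x] assms rot_image[of n] by simp

lemma shift_rot_subset: "x \<subseteq> {..<n} \<Longrightarrow> shift (rot n) a x \<subseteq> {..<n}"
  using image_mono[of x "{..<n}" "rot n"] rot_image[of n] by (simp add: shift_def)

lemma shift_rot_diff:
  "x \<subseteq> {..<n} \<Longrightarrow> shift (rot n) a ({..<n} - x) = {..<n} - shift (rot n) a x"
  by (simp add: shift_def rot_image_diff)

text \<open>The half of \<open>proper_words (Suc n)\<close> in which the index \<open>n\<close> is
  absent.\<close>

definition nonempty_words :: "nat \<Rightarrow> (nat set \<times> bool) set" where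
  "nonempty_words n = (Pow {..<n} - {{}}) \<times> UNIV"

text \<open>The codes of the base-cobases: a full rim set would contain the rim cycle, an empty one
  would leave it to the complement.\<close>

definition proper_words :: "nat \<Rightarrow> (nat set \<times> bool) set" where
  "proper_words n = (Pow {..<n} - {{}, {..<n}}) \<times> UNIV"

section \<open>Certificates for three rim edges\<close>

text \<open>The code of \<open>(x, a)\<close> with \<open>x \<subseteq> {0, 1, 2}\<close> has \<open>a\<close> as its lowest bit, above it the bits of \<open>x\<close>. The paths below
  were found by computer search; there is one for each pair of codes \<open>i < j\<close>, in lexicographic order.\<close>

definition code_word :: "nat \<Rightarrow> nat set \<times> bool" where
  "code_word k = ({i \<in> {0, 1, 2}. odd (k div 2 ^ Suc i)}, odd k)"

text \<open>With a separate edge list, adjacency is computed once per edge and each step of a path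
  is a list lookup.\<close>

definition nonempty_edges :: "(nat \<times> nat) list" where
  "nonempty_edges =
    [(2, 3), (2, 6), (2, 10), (3, 4), (3, 6), (3, 7), (3, 11), (4, 5), (4, 6), (4, 7), (4, 12),
    (5, 7), (5, 8), (5, 12), (5, 13), (6, 7), (6, 14), (7, 12), (7, 14), (7, 15), (8, 9), (8, 10),
    (8, 12), (8, 13), (9, 11), (9, 13), (10, 14), (11, 15), (12, 13), (12, 14), (12, 15),
    (13, 15), (14, 15)]"

definition nonempty_paths :: "nat list list" where
  "nonempty_paths =
    [[2, 10, 8, 9, 11, 15, 13, 5, 12, 14, 6, 4, 7, 3],
    [2, 10, 8, 9, 11, 3, 6, 14, 15, 13, 5, 7, 12, 4],
    [2, 10, 8, 9, 11, 3, 6, 4, 7, 14, 15, 12, 13, 5],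
    [2, 10, 8, 9, 11, 3, 4, 5, 13, 12, 15, 7, 14, 6],
    [2, 10, 8, 9, 11, 3, 6, 4, 5, 13, 12, 14, 15, 7],
    [2, 10, 14, 6, 3, 11, 9, 13, 15, 7, 4, 5, 12, 8],
    [2, 10, 8, 5, 13, 12, 4, 3, 6, 7, 14, 15, 11, 9],
    [2, 3, 11, 9, 8, 13, 5, 4, 6, 7, 12, 15, 14, 10],
    [2, 10, 8, 9, 13, 5, 4, 3, 6, 7, 12, 14, 15, 11],
    [2, 10, 8, 9, 11, 3, 6, 4, 5, 13, 15, 7, 14, 12],
    [2, 10, 8, 9, 11, 3, 6, 4, 5, 7, 14, 12, 15, 13],
    [2, 10, 8, 9, 11, 3, 6, 4, 5, 13, 12, 7, 15, 14],
    [2, 10, 8, 9, 11, 3, 6, 4, 5, 13, 12, 7, 14, 15],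
    [3, 2, 10, 8, 9, 11, 15, 13, 5, 12, 14, 6, 7, 4],
    [3, 2, 10, 8, 9, 11, 15, 13, 12, 14, 6, 4, 7, 5],
    [3, 2, 10, 8, 9, 11, 15, 13, 5, 4, 12, 7, 14, 6],
    [3, 2, 10, 8, 9, 11, 15, 13, 5, 4, 6, 14, 12, 7],
    [3, 2, 10, 14, 6, 4, 7, 5, 12, 15, 11, 9, 13, 8],
    [3, 2, 10, 8, 5, 4, 6, 7, 14, 12, 13, 15, 11, 9],
    [3, 2, 6, 4, 5, 7, 14, 12, 15, 11, 9, 13, 8, 10],
    [3, 2, 10, 8, 9, 13, 5, 4, 6, 7, 12, 14, 15, 11],
    [3, 2, 10, 8, 9, 11, 15, 13, 5, 4, 6, 7, 14, 12],
    [3, 2, 10, 8, 9, 11, 15, 14, 6, 4, 7, 5, 12, 13],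
    [3, 2, 10, 8, 9, 11, 15, 13, 5, 4, 6, 7, 12, 14],
    [3, 2, 10, 8, 5, 4, 6, 7, 14, 12, 13, 9, 11, 15],
    [4, 3, 2, 6, 7, 14, 10, 8, 9, 11, 15, 12, 13, 5],
    [4, 3, 2, 10, 8, 9, 11, 15, 13, 5, 12, 7, 14, 6],
    [4, 3, 2, 6, 14, 10, 8, 9, 11, 15, 13, 5, 12, 7],
    [4, 3, 2, 6, 7, 5, 12, 13, 9, 11, 15, 14, 10, 8],
    [4, 3, 2, 6, 7, 5, 8, 10, 14, 12, 13, 15, 11, 9],
    [4, 3, 2, 6, 7, 5, 8, 9, 11, 15, 13, 12, 14, 10],
    [4, 3, 2, 6, 7, 5, 8, 10, 14, 12, 15, 13, 9, 11],
    [4, 3, 2, 6, 7, 5, 8, 10, 14, 15, 11, 9, 13, 12],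
    [4, 3, 2, 6, 7, 5, 8, 10, 14, 12, 15, 11, 9, 13],
    [4, 3, 2, 6, 7, 5, 12, 13, 15, 11, 9, 8, 10, 14],
    [4, 3, 2, 6, 7, 5, 8, 10, 14, 12, 13, 9, 11, 15],
    [5, 4, 3, 2, 10, 8, 9, 11, 15, 13, 12, 7, 14, 6],
    [5, 4, 3, 2, 6, 14, 10, 8, 9, 11, 15, 13, 12, 7],
    [5, 4, 3, 2, 6, 7, 12, 13, 9, 11, 15, 14, 10, 8],
    [5, 4, 3, 2, 6, 7, 14, 10, 8, 12, 13, 15, 11, 9],
    [5, 4, 3, 2, 6, 7, 14, 12, 15, 11, 9, 13, 8, 10],
    [5, 4, 3, 2, 6, 7, 14, 10, 8, 9, 13, 12, 15, 11],
    [5, 4, 3, 2, 6, 7, 14, 10, 8, 9, 11, 15, 13, 12],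
    [5, 4, 3, 2, 6, 7, 14, 10, 8, 9, 11, 15, 12, 13],
    [5, 4, 3, 2, 6, 7, 12, 13, 15, 11, 9, 8, 10, 14],
    [5, 4, 3, 2, 6, 7, 14, 10, 8, 12, 13, 9, 11, 15],
    [6, 2, 10, 14, 15, 11, 3, 4, 5, 8, 9, 13, 12, 7],
    [6, 2, 10, 14, 15, 11, 3, 4, 7, 5, 12, 13, 9, 8],
    [6, 2, 10, 14, 15, 11, 3, 4, 7, 5, 12, 8, 13, 9],
    [6, 2, 3, 11, 9, 8, 13, 5, 4, 7, 12, 15, 14, 10],
    [6, 2, 10, 14, 15, 7, 3, 4, 5, 12, 8, 13, 9, 11],
    [6, 2, 10, 14, 15, 11, 3, 4, 7, 5, 8, 9, 13, 12],
    [6, 2, 10, 14, 15, 11, 3, 4, 7, 5, 12, 8, 9, 13],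
    [6, 2, 10, 8, 9, 11, 3, 4, 5, 13, 12, 7, 15, 14],
    [6, 2, 10, 14, 7, 3, 4, 5, 8, 12, 13, 9, 11, 15],
    [7, 3, 2, 6, 4, 5, 12, 13, 9, 11, 15, 14, 10, 8],
    [7, 3, 2, 6, 4, 5, 8, 10, 14, 12, 13, 15, 11, 9],
    [7, 3, 2, 6, 4, 5, 8, 9, 11, 15, 13, 12, 14, 10],
    [7, 3, 2, 6, 4, 5, 8, 10, 14, 12, 15, 13, 9, 11],
    [7, 3, 2, 6, 4, 5, 8, 10, 14, 15, 11, 9, 13, 12],
    [7, 3, 2, 6, 4, 5, 8, 10, 14, 12, 15, 11, 9, 13],
    [7, 3, 2, 6, 4, 5, 12, 13, 15, 11, 9, 8, 10, 14],
    [7, 3, 2, 6, 4, 5, 8, 10, 14, 12, 13, 9, 11, 15],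
    [8, 10, 2, 3, 11, 15, 14, 6, 4, 7, 5, 12, 13, 9],
    [8, 9, 11, 3, 2, 6, 4, 5, 13, 12, 7, 15, 14, 10],
    [8, 9, 13, 5, 4, 12, 15, 7, 14, 10, 2, 6, 3, 11],
    [8, 9, 11, 3, 2, 10, 14, 6, 4, 5, 7, 15, 13, 12],
    [8, 9, 11, 3, 2, 10, 14, 6, 4, 5, 7, 12, 15, 13],
    [8, 9, 11, 3, 4, 5, 13, 12, 15, 7, 6, 2, 10, 14],
    [8, 9, 11, 3, 2, 10, 14, 6, 4, 5, 7, 12, 13, 15],
    [9, 11, 3, 2, 6, 4, 5, 7, 14, 15, 12, 13, 8, 10],
    [9, 8, 10, 2, 3, 6, 4, 5, 13, 12, 7, 14, 15, 11],
    [9, 11, 3, 2, 10, 8, 13, 5, 4, 6, 7, 14, 15, 12],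
    [9, 11, 3, 2, 10, 8, 5, 4, 6, 7, 14, 12, 15, 13],
    [9, 11, 3, 2, 10, 8, 13, 5, 4, 6, 7, 12, 15, 14],
    [9, 11, 3, 2, 10, 8, 13, 5, 4, 6, 7, 12, 14, 15],
    [10, 2, 3, 6, 4, 5, 7, 14, 12, 8, 9, 13, 15, 11],
    [10, 2, 3, 11, 9, 8, 13, 5, 4, 6, 7, 14, 15, 12],
    [10, 2, 3, 11, 9, 8, 5, 4, 6, 7, 14, 12, 15, 13],
    [10, 2, 3, 11, 9, 8, 13, 5, 4, 6, 7, 12, 15, 14],
    [10, 2, 3, 11, 9, 8, 13, 5, 4, 6, 7, 12, 14, 15],
    [11, 9, 8, 10, 2, 3, 6, 4, 5, 13, 15, 7, 14, 12],
    [11, 9, 8, 10, 2, 3, 6, 4, 5, 7, 14, 12, 15, 13],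
    [11, 9, 8, 10, 2, 3, 6, 4, 5, 13, 12, 7, 15, 14],
    [11, 9, 8, 10, 2, 3, 6, 4, 5, 13, 12, 7, 14, 15],
    [12, 4, 5, 8, 9, 11, 3, 2, 10, 14, 6, 7, 15, 13],
    [12, 4, 5, 8, 9, 13, 15, 11, 3, 7, 6, 2, 10, 14],
    [12, 4, 5, 8, 10, 2, 6, 14, 7, 3, 11, 9, 13, 15],
    [13, 9, 11, 15, 12, 8, 5, 4, 3, 7, 6, 2, 10, 14],
    [13, 9, 11, 3, 2, 10, 8, 5, 4, 6, 7, 12, 14, 15],
    [14, 10, 2, 6, 3, 11, 9, 8, 13, 5, 4, 7, 12, 15]]"

definition proper_edges :: "(nat \<times> nat) list" where
  "proper_edges =
    [(2, 3), (2, 6), (2, 9), (2, 10), (2, 11), (3, 4), (3, 6), (3, 7), (3, 11), (4, 5), (4, 6),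
    (4, 7), (4, 12), (5, 7), (5, 8), (5, 12), (5, 13), (6, 7), (6, 11), (7, 12), (8, 9), (8, 10),
    (8, 12), (8, 13), (9, 10), (9, 11), (9, 13), (10, 11), (10, 13), (12, 13)]"

definition proper_paths :: "nat list list" where
  "proper_paths =
    [[2, 6, 11, 9, 10, 8, 13, 5, 12, 4, 7, 3],
    [2, 3, 6, 11, 9, 10, 8, 13, 5, 7, 12, 4],
    [2, 3, 6, 11, 9, 10, 8, 13, 12, 4, 7, 5],
    [2, 3, 11, 9, 10, 8, 13, 5, 12, 4, 7, 6],
    [2, 3, 6, 11, 9, 10, 8, 13, 5, 4, 12, 7],
    [2, 3, 6, 11, 9, 10, 13, 5, 4, 7, 12, 8],
    [2, 3, 6, 11, 10, 8, 5, 4, 7, 12, 13, 9],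
    [2, 3, 6, 11, 9, 8, 5, 4, 7, 12, 13, 10],
    [2, 3, 6, 4, 7, 5, 12, 8, 13, 9, 10, 11],
    [2, 3, 6, 11, 9, 10, 8, 13, 5, 4, 7, 12],
    [2, 3, 6, 11, 9, 10, 8, 5, 4, 7, 12, 13],
    [3, 2, 6, 11, 9, 10, 8, 13, 5, 7, 12, 4],
    [3, 2, 6, 11, 9, 10, 8, 13, 12, 4, 7, 5],
    [3, 2, 11, 9, 10, 8, 13, 5, 12, 4, 7, 6],
    [3, 2, 6, 11, 9, 10, 8, 13, 5, 4, 12, 7],
    [3, 2, 6, 11, 9, 10, 13, 5, 4, 7, 12, 8],
    [3, 2, 6, 11, 10, 8, 5, 4, 7, 12, 13, 9],
    [3, 2, 6, 11, 9, 8, 5, 4, 7, 12, 13, 10],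
    [3, 2, 6, 4, 7, 5, 12, 8, 13, 9, 10, 11],
    [3, 2, 6, 11, 9, 10, 8, 13, 5, 4, 7, 12],
    [3, 2, 6, 11, 9, 10, 8, 5, 4, 7, 12, 13],
    [4, 3, 6, 7, 12, 8, 9, 2, 11, 10, 13, 5],
    [4, 3, 7, 5, 12, 8, 13, 9, 10, 2, 11, 6],
    [4, 3, 6, 2, 11, 9, 10, 8, 13, 5, 12, 7],
    [4, 3, 6, 7, 5, 12, 13, 9, 2, 11, 10, 8],
    [4, 3, 6, 7, 5, 12, 8, 13, 10, 2, 11, 9],
    [4, 3, 6, 7, 5, 12, 8, 13, 9, 2, 11, 10],
    [4, 3, 6, 7, 5, 12, 8, 13, 9, 2, 10, 11],
    [4, 3, 6, 7, 5, 8, 9, 2, 11, 10, 13, 12],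
    [4, 3, 6, 7, 5, 12, 8, 9, 2, 11, 10, 13],
    [5, 4, 7, 12, 8, 13, 9, 10, 2, 3, 11, 6],
    [5, 4, 12, 8, 13, 9, 10, 2, 11, 3, 6, 7],
    [5, 4, 7, 12, 13, 9, 2, 3, 6, 11, 10, 8],
    [5, 4, 7, 12, 8, 13, 10, 2, 3, 6, 11, 9],
    [5, 4, 7, 12, 8, 13, 9, 2, 3, 6, 11, 10],
    [5, 4, 7, 12, 8, 13, 9, 10, 2, 3, 6, 11],
    [5, 4, 7, 3, 6, 2, 11, 9, 10, 8, 13, 12],
    [5, 4, 7, 12, 8, 9, 2, 3, 6, 11, 10, 13],
    [6, 2, 3, 11, 9, 10, 8, 13, 5, 4, 12, 7],
    [6, 2, 3, 11, 9, 10, 13, 5, 4, 7, 12, 8],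
    [6, 2, 3, 11, 10, 8, 5, 4, 7, 12, 13, 9],
    [6, 2, 3, 11, 9, 8, 5, 4, 7, 12, 13, 10],
    [6, 2, 3, 4, 7, 5, 12, 8, 13, 9, 10, 11],
    [6, 2, 3, 11, 9, 10, 8, 13, 5, 4, 7, 12],
    [6, 2, 3, 11, 9, 10, 8, 5, 4, 7, 12, 13],
    [7, 3, 4, 6, 2, 11, 9, 10, 13, 5, 12, 8],
    [7, 3, 4, 6, 2, 11, 10, 8, 5, 12, 13, 9],
    [7, 3, 4, 6, 2, 11, 9, 8, 5, 12, 13, 10],
    [7, 3, 4, 6, 2, 9, 8, 5, 12, 13, 10, 11],
    [7, 3, 4, 6, 2, 11, 9, 10, 8, 5, 13, 12],
    [7, 3, 4, 6, 2, 11, 9, 10, 8, 5, 12, 13],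
    [8, 5, 12, 13, 10, 2, 3, 4, 7, 6, 11, 9],
    [8, 5, 12, 13, 9, 2, 3, 4, 7, 6, 11, 10],
    [8, 5, 12, 13, 9, 10, 2, 3, 4, 7, 6, 11],
    [8, 5, 13, 9, 10, 2, 11, 3, 6, 4, 7, 12],
    [8, 5, 12, 4, 7, 3, 6, 2, 11, 9, 10, 13],
    [9, 2, 11, 3, 6, 4, 7, 5, 12, 8, 13, 10],
    [9, 2, 10, 8, 13, 5, 12, 4, 7, 3, 6, 11],
    [9, 2, 10, 11, 3, 6, 4, 7, 5, 8, 13, 12],
    [9, 2, 10, 11, 3, 6, 4, 7, 5, 8, 12, 13],
    [10, 2, 9, 8, 13, 5, 12, 4, 7, 3, 6, 11],
    [10, 2, 9, 11, 3, 6, 4, 7, 5, 8, 13, 12],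
    [10, 2, 9, 11, 3, 6, 4, 7, 5, 8, 12, 13],
    [11, 2, 3, 6, 4, 7, 5, 8, 9, 10, 13, 12],
    [11, 2, 3, 6, 4, 7, 5, 12, 8, 9, 10, 13],
    [12, 4, 5, 7, 3, 6, 2, 11, 9, 8, 10, 13]]"

text \<open>The equation on \<open>sort p\<close> says that \<open>p\<close> visits every code
  exactly once. Codes 0 and 1 have the empty rim set, 14 and 15 the full one, whence the ranges up
  to 16 and up to 14 starting at 2.\<close>

definition certifies :: "nat \<Rightarrow> (nat \<times> nat) list \<Rightarrow> nat list list \<Rightarrow> bool" where
  "certifies m E ws \<longleftrightarrow> (\<forall>p\<in>set ws. sort p = [2..<m] \<and> successively (\<lambda>i j. (i, j) \<in> set E \<or> (j, i) \<in> set E) p) \<and>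
    map (\<lambda>p. (hd p, last p)) ws = [(i, j). i \<leftarrow> [2..<m], j \<leftarrow> [Suc i..<m]]"

lemma certifies_nonempty: "certifies 16 nonempty_edges nonempty_paths" by code_simp
lemma adj_nonempty_edges: "\<forall>(i,j) \<in> set nonempty_edges. adj Suc (code_word i) (code_word j)" by code_simp
lemma certifies_proper: "certifies 14 proper_edges proper_paths" by code_simp
lemma adj_proper_edges: "\<forall>(i,j) \<in> set proper_edges. adj (rot 3) (code_word i) (code_word j)" by code_simp

text \<open>Injectivity of \<open>code_word\<close> carries the listed paths over to words; pairs in
  decreasing order get the reversed path.\<close>

lemma ham_connected_by_witnesses:
  assumes "certifies m E ws" "\<forall>(i, j) \<in> set E. R (code_word i) (code_word j)" "symp R"
    and inj: "inj_on code_word {2..<m}" and uv: "u \<in> code_word ` {2..<m}" "v \<in> code_word ` {2..<m}" "u \<noteq> v"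
  shows "ham R (code_word ` {2..<m}) u v"
proof -
  have *: "ham R (code_word ` {2..<m}) (code_word i) (code_word j)" if "2 \<le> i" "i < j" "j < m" for i j
  proof -
    have "(i, j) \<in> set [(i, j). i \<leftarrow> [2..<m], j \<leftarrow> [Suc i..<m]]"
      using that by force
    then have "(i, j) \<in> set (map (\<lambda>p. (hd p, last p)) ws)"
      using assms(1) unfolding certifies_def by metis
    then obtain p where p: "p \<in> set ws" "hd p = i" "last p = j" by auto
    with assms(1) have s: "sort p = [2..<m]"
      and succ: "successively (\<lambda>i j. (i, j) \<in> set E \<or> (j, i) \<in> set E) p"
      unfolding certifies_def by auto
    have "set p = {2..<m}" "distinct p" using s
      by (metis set_sort set_upt, metis distinct_sort distinct_upt)
    moreover from this have "p \<noteq> []" using that by auto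
    ultimately have "ham (\<lambda>i j. (i, j) \<in> set E \<or> (j, i) \<in> set E) {2..<m} i j"
      unfolding ham_def using p succ by blast
    then show ?thesis
      by (rule ham_map) (use inj assms(2,3) in \<open>auto dest: sympD\<close>)
  qed
  from uv obtain i j where ij: "i \<in> {2..<m}" "j \<in> {2..<m}" "u = code_word i" "v = code_word j" "i \<noteq> j"
    by blast
  then consider "i < j" | "j < i" by linarith
  then show ?thesis
    using *[of i j] ham_rev[OF *[of j i] \<open>symp R\<close>] ij by cases auto
qed

lemma inj_on_code: "inj_on code_word {2..<16}"
proof -
  have "distinct (map code_word [2..<16])" by code_simp
  then show ?thesis by (metis distinct_map set_upt)
qed

lemma nat_upto_3: "{..<3} = {0, 1, 2::nat}"
  by (auto simp: less_Suc_eq numeral_3_eq_3)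

lemma codes_nonempty_words: "code_word ` {2..<16} = nonempty_words 3"
proof -
  have "set (map code_word [2..<16]) = (Pow (set [0, 1, 2]) - {{}}) \<times> {True, False}" by code_simp
  then show ?thesis unfolding nonempty_words_def nat_upto_3 UNIV_bool set_map set_upt by simp (metis insert_commute)
qed

lemma codes_proper_words: "code_word ` {2..<14} = (Pow {..<3} - {{}, {..<3}}) \<times> UNIV"
proof -
  have "set (map code_word [2..<14]) = (Pow (set [0, 1, 2]) - {{}, set [0, 1, 2]}) \<times> {True, False}" by code_simp
  then show ?thesis unfolding nat_upto_3 UNIV_bool set_map set_upt by simp (metis insert_commute)
qed

section \<open>Hamiltonian connectedness of the word graphs\<close>

text \<open>Every Hamiltonian path therefore has an edge at \<open>({0, 2}, a)\<close> inside the copy \<open>a\<close>, at which a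
  detour through a new cube of that copy can be inserted.\<close>

lemma no_cross_edge:
  assumes "adj Suc ({0, 2}, a) (y, b)" "finite y"
  shows "a = b"
proof (rule ccontr)
  assume "a \<noteq> b"
  let ?D = "sym_diff {0, 2} y"
  show False
  proof (cases a)
    case True
    \<comment> \<open>\<open>{1, 3}\<close> is the image of \<open>{0, 2}\<close> under
      \<open>Suc\<close>. Each of 0, 1, 2, 3 lies in exactly one of these two sets, so it is counted
      whether or not it is in \<open>y\<close>.\<close>
    let ?E = "sym_diff {1, 3} y"
    have "card ?D + card ?E = 2"
      using assms(1) True \<open>a \<noteq> b\<close> by (simp add: adj_def shift_def numeral_3_eq_3 numeral_2_eq_2)
    moreover have "card {0, 1, 2, 3::nat} \<le> card (?D \<union> ?E)"
      using \<open>finite y\<close> by (intro card_mono) auto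
    ultimately show False using card_Un_le[of ?D ?E] by simp
  next
    case False
    let ?E = "sym_diff {0, 2} (Suc ` y)"
    have *: "card ?D + card ?E = 2"
      using assms(1) False \<open>a \<noteq> b\<close> by (simp add: adj_def shift_def)
    have D: "card A \<le> card ?D" if "A \<subseteq> ?D" for A using \<open>finite y\<close> that by (intro card_mono) auto
    have E: "card A \<le> card ?E" if "A \<subseteq> ?E" for A using \<open>finite y\<close> that by (intro card_mono) auto
    \<comment> \<open>0 is never a successor, so it always counts in \<open>?E\<close>. Each of 0
      and 2 counts in \<open>?D\<close> if it is missing from \<open>y\<close>, and otherwise its
      successor counts in \<open>?E\<close>; the total is at least 3.\<close>
    consider "0 \<in> y" "2 \<in> y" | "0 \<in> y" "2 \<notin> y" | "0 \<notin> y" "2 \<in> y" | "0 \<notin> y" "2 \<notin> y" by blast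
    then show False
    proof cases
      case 1 then show False using E[of "{0, 1, 3}"] * by auto
    next
      case 2 then show False using E[of "{0, 1}"] D[of "{2}"] * by auto
    next
      case 3 then show False using E[of "{0, 3}"] D[of "{0}"] * by auto
    next
      case 4 then show False using E[of "{0}"] D[of "{0, 2}"] * by auto
    qed
  qed
qed

text \<open>The edge used at \<open>({0, 2}, a)\<close> has ends that differ in one index, so adding
  \<open>n\<close> to both gives vertices of opposite parity in the new cube, where
  \<open>ham_cube\<close> applies. \<open>V\<close> is prescribed only in copy \<open>a\<close>,
  since the other copy may already have its cube.\<close>

lemma ham_add_cube:
  assumes "n \<ge> 3" "ham (adj Suc) V u v" "u \<noteq> v"
    and V: "\<And>x. (x, a) \<in> V \<longleftrightarrow> (x, a) \<in> nonempty_words n" "\<And>x b. (x, b) \<in> V \<Longrightarrow> finite x"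
  shows "ham (adj Suc) (V \<union> {{n}..{..n}} \<times> {a}) u v"
proof (rule ham_detour_at[OF assms(2,3) _ symp_adj])
  show "({0, 2}, a) \<in> V" unfolding V(1) using \<open>n \<ge> 3\<close> by (auto simp: nonempty_words_def)
  have "n \<notin> x" if "(x, a) \<in> V" for x using that unfolding V(1) by (auto simp: nonempty_words_def)
  then show "V \<inter> {{n}..{..n}} \<times> {a} = {}" by auto
next
  fix d assume d: "d \<in> V" "adj Suc ({0, 2}, a) d"
  obtain y b where yb: "d = (y, b)" by force
  with d V(2) have "finite y" "b = a" using no_cross_edge by blast+
  with d yb have y: "y \<subseteq> {..<n}" using V(1)[of y] by (simp add: nonempty_words_def)
  have "card (sym_diff {0, 2} y) = 1"
    using d(2) unfolding yb \<open>b = a\<close> by (rule adj_same_iff[THEN iffD1, rotated]) (rule inj_Suc)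
  then have "even (card {0, 2::nat}) \<noteq> even (card y)"
    using even_card_sym_diff[of "{0, 2}" y] \<open>finite y\<close> by simp
  moreover have "n \<notin> {0, 2}" "n \<notin> y" using \<open>n \<ge> 3\<close> y by auto
  ultimately have "even (card (insert n {0, 2})) \<noteq> even (card (insert n y))"
    using \<open>finite y\<close> by auto
  then have "ham (adj Suc) ({{n}..{..n}} \<times> {a}) (insert n {0, 2}, a) (insert n y, a)"
    by (intro ham_cube) (use y \<open>n \<ge> 3\<close> in auto)
  then show "\<exists>c' d'. adj Suc ({0, 2}, a) c' \<and> adj Suc d d' \<and> ham (adj Suc) ({{n}..{..n}} \<times> {a}) c' d'"
    using adj_insert(1)[of Suc n "{0, 2}" a] adj_insert(1)[of Suc n y a] yb \<open>b = a\<close>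
      \<open>n \<notin> {0, 2}\<close> \<open>n \<notin> y\<close> by auto
qed

lemma nonempty_words_Suc: "nonempty_words (Suc n) = nonempty_words n \<union> {{n}..{..n}} \<times> {a} \<union> {{n}..{..n}} \<times> {\<not> a}"
proof -
  have "Pow {..<Suc n} = Pow {..<n} \<union> {{n}..{..n}}"
    by (auto simp: subset_eq less_Suc_eq order_le_less)
  then have "Pow {..<Suc n} - {{}} = (Pow {..<n} - {{}}) \<union> {{n}..{..n}}" by auto
  moreover have "(P \<union> Q) \<times> UNIV = P \<times> UNIV \<union> Q \<times> {a} \<union> Q \<times> {\<not> a}" for P Q :: "nat set set"
    by auto
  ultimately show ?thesis unfolding nonempty_words_def by (simp only:)
qed

text \<open>There are two candidates of the wanted parity, and \<open>w\<close> rules out at most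
  one. This chooses where a path crosses between the old words and a new cube.\<close>

lemma ex_opposite_parity:
  fixes x w :: "nat set"
  assumes "n \<ge> 3"
  shows "\<exists>z. z \<noteq> {} \<and> z \<noteq> w \<and> z \<subseteq> {..<n} \<and> even (card z) \<noteq> even (card x)"
proof (cases "even (card x)")
  case True
  have "{0} \<noteq> w \<or> {1} \<noteq> w" by auto
  then obtain i :: nat where "{i} \<noteq> w" "i \<le> 1" by auto
  then show ?thesis using True assms by (intro exI[of _ "{i}"]) auto
next
  case False
  have "1 \<in> {0, 1 :: nat}" "1 \<notin> {0, 2 :: nat}" by simp_all
  then have "{0, 1} \<noteq> w \<or> {0, 2} \<noteq> w" by metis
  then obtain i :: nat where "{0, i} \<noteq> w" "i = 1 \<or> i = 2" by blast
  then show ?thesis using False assms by (intro exI[of _ "{0, i}"]) auto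
qed

text \<open>The new words form two cubes \<open>T a\<close> on top of
  \<open>nonempty_words n\<close>. A cube that contains neither endpoint is inserted as a detour;
  the cases say where the endpoints lie.\<close>

lemma ham_nonempty_words_Suc:
  assumes "n \<ge> 3" and IH: "\<And>u v. u \<in> nonempty_words n \<Longrightarrow> v \<in> nonempty_words n \<Longrightarrow> u \<noteq> v \<Longrightarrow> ham (adj Suc) (nonempty_words n) u v"
    and uv: "u \<in> nonempty_words (Suc n)" "v \<in> nonempty_words (Suc n)" "u \<noteq> v"
  shows "ham (adj Suc) (nonempty_words (Suc n)) u v"
proof -
  define T where "T a = {{n}..{..n}} \<times> {a}" for a :: bool
  have T_Suc: "nonempty_words (Suc n) = nonempty_words n \<union> T a \<union> T (\<not> a)" for a using nonempty_words_Suc T_def by simp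
  have finJ: "finite x" if "(x, b) \<in> nonempty_words n \<union> T a" for x a b
    using that by (auto simp: nonempty_words_def T_def intro: finite_subset)
  have Tiff: "(x, b) \<in> T a \<longleftrightarrow> b = a \<and> (\<exists>y. x = insert n y \<and> y \<subseteq> {..<n})" for x a b
    unfolding T_def by (auto intro!: exI[of _ "x - {n}"] simp: subset_eq order_le_less)
  have add: "ham (adj Suc) (nonempty_words (Suc n)) u v" if "ham (adj Suc) (nonempty_words n \<union> T a) u v" for a
    unfolding T_Suc[of a] using ham_add_cube[OF \<open>n \<ge> 3\<close> that \<open>u \<noteq> v\<close>, of "\<not> a"] finJ
    by (auto simp: T_def)
  have up: "adj Suc (x, a) (insert n x, a)" "adj Suc (insert n x, a) (x, a)" if "x \<subseteq> {..<n}" for x a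
    using that by (intro adj_insert; auto)+
  have JT: "nonempty_words n \<inter> T a = {}" "T a \<inter> nonempty_words n = {}" for a by (auto simp: nonempty_words_def Tiff)
  have par: "even (card (insert n x)) \<longleftrightarrow> odd (card x)" if "x \<subseteq> {..<n}" for x
    using that finite_subset[OF that] by (subst card_insert_disjoint) auto
  have cubeT: "ham (adj Suc) (T a) (insert n x, a) (insert n y, a)"
    if "x \<subseteq> {..<n}" "y \<subseteq> {..<n}" "even (card x) \<noteq> even (card y)" for x y a
    unfolding T_def by (rule ham_cube) (use that par in auto)
  note pick = ex_opposite_parity[OF \<open>n \<ge> 3\<close>]
  \<comment> \<open>\<open>z\<close> differs from \<open>u\<close>, so the old words have a path
    from \<open>u\<close> to \<open>(z, a)\<close>; its parity is opposite to that of
    \<open>y\<close>, so the cube has a path from above \<open>(z, a)\<close> to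
    \<open>v\<close>.\<close>
  have mixed: "ham (adj Suc) (nonempty_words n \<union> T a) u v" if u: "u \<in> nonempty_words n" and v: "v \<in> T a" for u v a
  proof -
    obtain y where y: "v = (insert n y, a)" "y \<subseteq> {..<n}" using v Tiff by (cases v) auto
    obtain z where z: "z \<noteq> {}" "z \<noteq> fst u" "z \<subseteq> {..<n}" "even (card z) \<noteq> even (card y)"
      using pick[of "fst u" y] by blast
    have "(z, a) \<in> nonempty_words n" "u \<noteq> (z, a)" using z by (auto simp: nonempty_words_def)
    then show ?thesis
      using ham_join[OF IH[OF u] cubeT[OF z(3) y(2) z(4)] up(1)[OF z(3)]] JT y by auto
  qed
  consider "u \<in> nonempty_words n" "v \<in> nonempty_words n" | a where "u \<in> nonempty_words n" "v \<in> T a" | a where "u \<in> T a" "v \<in> nonempty_words n"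
    | a where "u \<in> T a" "v \<in> T (\<not> a)" | a where "u \<in> T a" "v \<in> T a"
    using uv(1,2) T_Suc[of True] by auto
  then show ?thesis
  proof cases
    case 1
    then have "ham (adj Suc) (nonempty_words n \<union> {{n}..{..n}} \<times> {True}) u v"
      using finJ by (intro ham_add_cube IH assms) auto
    then show ?thesis using add[of True] by (simp add: T_def)
  next
    case 2 then show ?thesis using mixed add by blast
  next
    case 3 then show ?thesis using ham_rev[OF mixed symp_adj] add by blast
  next
    \<comment> \<open>The path exhausts the cube of \<open>u\<close>, descends to the old words and
      ends in the other cube by \<open>mixed\<close>.\<close>
    case (4 a)
    obtain x where x: "u = (insert n x, a)" "x \<subseteq> {..<n}" using 4 Tiff by (cases u) auto
    obtain z where z: "z \<noteq> {}" "z \<subseteq> {..<n}" "even (card x) \<noteq> even (card z)"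
      using pick[of "{}" x] by blast
    have "(z, a) \<in> nonempty_words n" using z by (auto simp: nonempty_words_def)
    moreover have "T a \<inter> (nonempty_words n \<union> T (\<not> a)) = {}" using JT by (auto simp: T_def)
    ultimately have "ham (adj Suc) (T a \<union> (nonempty_words n \<union> T (\<not> a))) u v"
      unfolding x(1) using 4(2) by (intro ham_join[OF cubeT[OF x(2) z(2,3)] mixed up(2)[OF z(2)]])
    then show ?thesis using T_Suc[of a] by (simp add: Un_ac)
  next
    \<comment> \<open>\<open>x\<close> and \<open>y\<close> may have equal parity, so the cube is
      halved at an index \<open>c\<close> separating them: one half, then the old words, then the
      other half.\<close>
    case (5 a)
    obtain x where x: "u = (insert n x, a)" "x \<subseteq> {..<n}" using 5 Tiff by (cases u) auto
    obtain y where y: "v = (insert n y, a)" "y \<subseteq> {..<n}" using 5 Tiff by (cases v) auto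
    have "x \<noteq> y" using uv(3) x y by auto
    then obtain c where c: "c \<in> x \<longleftrightarrow> c \<notin> y" by blast
    have cn: "c < n" using c x y by auto
    define P where "P d = {z \<in> {{n}..{..n}}. c \<in> z \<longleftrightarrow> d}" for d
    have P: "P True = {{n, c}..{..n}}" "P False = {{n}..{..n} - {c}}"
      using cn by (auto simp: P_def)
    have half: "ham (adj Suc) (P d \<times> {a}) (z, a) (w, a)"
      if "z \<in> P d" "w \<in> P d" "even (card z) \<noteq> even (card w)" for d z w
      using that P by (cases d) (auto intro!: ham_cube)
    have ex: "\<exists>z. z \<noteq> {} \<and> z \<subseteq> {..<n} \<and> (c \<in> z \<longleftrightarrow> c \<in> x) \<and> even (card z) \<noteq> even (card x)"
      if "x \<subseteq> {..<n}" for x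
    proof -
      \<comment> \<open>Toggling \<open>i\<close> flips the parity, \<open>i \<noteq> c\<close>
        keeps the half, and \<open>{i} \<noteq> x\<close> avoids the empty set. Of 0, 1 and 2 at
        most two are excluded.\<close>
      have "\<exists>i<n. i \<noteq> c \<and> {i} \<noteq> x"
      proof (rule ccontr)
        assume "\<not> ?thesis"
        then have *: "i = c \<or> {i} = x" if "i < n" for i using that by blast
        show False using *[of 0] *[of 1] *[of 2] \<open>n \<ge> 3\<close> by auto
      qed
      then obtain i where "i < n" "i \<noteq> c" "{i} \<noteq> x" by blast
      then show ?thesis
        using that even_card_toggle[OF finite_subset[OF that], of i]
        by (intro exI[of _ "toggle i x"]) (auto simp: toggle_def)
    qed
    obtain z where z: "z \<noteq> {}" "z \<subseteq> {..<n}" "c \<in> z \<longleftrightarrow> c \<in> x" "even (card z) \<noteq> even (card x)"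
      using ex[OF x(2)] by blast
    obtain w where w: "w \<noteq> {}" "w \<subseteq> {..<n}" "c \<in> w \<longleftrightarrow> c \<in> y" "even (card w) \<noteq> even (card y)"
      using ex[OF y(2)] by blast
    have inP: "insert n x' \<in> P d \<longleftrightarrow> (c \<in> x' \<longleftrightarrow> d)" if "x' \<subseteq> {..<n}" for x' d
      using that cn by (auto simp: P_def)
    have 1: "ham (adj Suc) (P (c \<in> x) \<times> {a}) u (insert n z, a)"
      unfolding x(1) by (rule half) (use x z inP par in auto)
    have 2: "ham (adj Suc) (P (c \<in> y) \<times> {a}) (insert n w, a) v"
      unfolding y(1) by (rule half) (use y w inP par in auto)
    have 3: "ham (adj Suc) (nonempty_words n) (z, a) (w, a)"
      using IH[of "(z, a)" "(w, a)"] z w c by (auto simp: nonempty_words_def)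
    have TP: "T a = P (c \<in> x) \<times> {a} \<union> P (c \<in> y) \<times> {a}" "P (c \<in> x) \<inter> P (c \<in> y) = {}"
      using c by (auto simp: P_def T_def)
    have "ham (adj Suc) (P (c \<in> x) \<times> {a} \<union> nonempty_words n \<union> P (c \<in> y) \<times> {a}) u v"
    proof (rule ham_join[OF ham_join[OF 1 3 up(2)[OF z(2)]] 2 up(1)[OF w(2)]])
      show "P (c \<in> x) \<times> {a} \<inter> nonempty_words n = {}" using JT(1)[of a] TP(1) by blast
      show "(P (c \<in> x) \<times> {a} \<union> nonempty_words n) \<inter> P (c \<in> y) \<times> {a} = {}" using JT(1)[of a] TP by blast
    qed
    then show ?thesis using add[of a] TP(1) by (simp add: Un_ac)
  qed
qed

lemma ham_nonempty_words:
  assumes "n \<ge> 3" "u \<in> nonempty_words n" "v \<in> nonempty_words n" "u \<noteq> v"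
  shows "ham (adj Suc) (nonempty_words n) u v"
  using assms
proof (induction n arbitrary: u v rule: dec_induct)
  case base
  then show ?case
    using ham_connected_by_witnesses[OF certifies_nonempty adj_nonempty_edges symp_adj inj_on_code] codes_nonempty_words by metis
next
  case (step n)
  then show ?case by (intro ham_nonempty_words_Suc)
qed

section \<open>Gluing a half to its complement\<close>

lemma ex_adjacent_avoiding:
  assumes "distinct p" "length p \<ge> 6"
  shows "\<exists>ps z w qs. p = ps @ z # w # qs \<and> z \<notin> {f, g} \<and> w \<notin> {f, g}"
proof -
  from assms(2) obtain a b c d e h r where p: "p = a # b # c # d # e # h # r"
    by (auto simp: numeral_eq_Suc Suc_le_length_iff)
  \<comment> \<open>Three disjoint consecutive pairs; \<open>f\<close> and \<open>g\<close> can
    spoil at most two of them.\<close>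
  from assms(1) p consider "a \<notin> {f, g}" "b \<notin> {f, g}" | "c \<notin> {f, g}" "d \<notin> {f, g}"
    | "e \<notin> {f, g}" "h \<notin> {f, g}"
    by auto
  then show ?thesis
  proof cases
    case 1 then show ?thesis using p by (intro exI[of _ "[]"]) auto
  next
    case 2 then show ?thesis using p by (intro exI[of _ "[a, b]"]) auto
  next
    case 3 then show ?thesis using p by (intro exI[of _ "[a, b, c, d]"]) auto
  qed
qed

lemma finite_nonempty_words: "finite (nonempty_words n)" by (simp add: nonempty_words_def)

lemma card_nonempty_words_ge: "n \<ge> 3 \<Longrightarrow> card (nonempty_words n) \<ge> 6"
proof -
  assume "n \<ge> 3"
  have "card ({{0}, {1}, {2 :: nat}} \<times> (UNIV :: bool set)) \<le> card (nonempty_words n)"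
    by (rule card_mono[OF finite_nonempty_words]) (use \<open>n \<ge> 3\<close> in \<open>auto simp: nonempty_words_def\<close>)
  then show ?thesis by (simp add: card_cartesian_product)
qed

text \<open>Under the encoding this is the complement of the edge set, by
  \<open>edges_diff_tree\<close> and \<open>shift_rot_diff\<close>.\<close>

definition complement :: "nat \<Rightarrow> nat set \<times> bool \<Rightarrow> nat set \<times> bool" where
  "complement n u = ({..<n} - fst u, snd u)"

text \<open>The rotation permutes the indices, so it commutes with complementation, which preserves
  symmetric differences.\<close>

lemma adj_complement:
  assumes "fst u \<subseteq> {..<n}" "fst v \<subseteq> {..<n}" "adj (rot n) u v"
  shows "adj (rot n) (complement n u) (complement n v)"
proof -
  have sd: "sym_diff (C - x) (C - y) = sym_diff x y" if "x \<subseteq> C" "y \<subseteq> C" for x y C :: "nat set"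
    using that by auto
  show ?thesis
    using assms by (simp add: adj_def complement_def shift_rot_diff shift_rot_subset sd)
qed

text \<open>The index \<open>n\<close> separates the halves; complementing exchanges its presence
  with its absence, and properness with nonemptiness.\<close>

lemma proper_words_Suc: "proper_words (Suc n) = nonempty_words n \<union> complement (Suc n) ` nonempty_words n"
proof -
  have C_iff: "(x, a) \<in> complement (Suc n) ` nonempty_words n \<longleftrightarrow> n \<in> x \<and> x \<subset> {..<Suc n}" for x a
  proof
    assume "n \<in> x \<and> x \<subset> {..<Suc n}"
    then show "(x, a) \<in> complement (Suc n) ` nonempty_words n"
      by (intro image_eqI[of _ _ "({..<Suc n} - x, a)"]) (auto simp: complement_def nonempty_words_def less_Suc_eq)
  next
    assume "(x, a) \<in> complement (Suc n) ` nonempty_words n"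
    then obtain u where u: "u \<in> nonempty_words n" "(x, a) = complement (Suc n) u" by (rule imageE)
    then have "x = {..<Suc n} - fst u" "fst u \<subseteq> {..<n}" "fst u \<noteq> {}"
      by (simp_all add: complement_def nonempty_words_def mem_Times_iff)
    moreover from this obtain t where "t \<in> fst u" "t < n" by blast
    ultimately have "n \<in> x" "t \<notin> x" "x \<subseteq> {..<Suc n}" "t < Suc n" by auto
    then show "n \<in> x \<and> x \<subset> {..<Suc n}" by blast
  qed
  have J_iff: "(x, a) \<in> nonempty_words n \<longleftrightarrow> n \<notin> x \<and> x \<noteq> {} \<and> x \<subset> {..<Suc n}" for x a
    by (auto simp: nonempty_words_def less_Suc_eq)
  have H_iff: "(x, a) \<in> proper_words (Suc n) \<longleftrightarrow> x \<noteq> {} \<and> x \<subset> {..<Suc n}" for x a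
    by (auto simp: proper_words_def)
  have "(x, a) \<in> proper_words (Suc n) \<longleftrightarrow> (x, a) \<in> nonempty_words n \<union> complement (Suc n) ` nonempty_words n" for x a
    unfolding Un_iff C_iff J_iff H_iff by blast
  then show ?thesis by (intro set_eqI) (metis surj_pair)
qed

lemma complement_complement: "u \<in> proper_words n \<Longrightarrow> complement n (complement n u) = u"
  by (auto simp: complement_def proper_words_def double_diff)

lemma complement_in_proper_words: "u \<in> proper_words n \<Longrightarrow> complement n u \<in> proper_words n"
  by (auto simp: complement_def proper_words_def)

lemma complement_proper_words: "complement n ` proper_words n = proper_words n"
  using complement_in_proper_words complement_complement by (metis (no_types, lifting) image_subset_iff subset_antisym image_eqI subsetI)

lemma inj_on_complement: "inj_on (complement n) (proper_words n)"
  by (metis inj_on_inverseI complement_complement)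

text \<open>Both halves are Hamiltonian connected, the second one through \<open>complement\<close>,
  and flipping \<open>n\<close> links them. Endpoints in different halves need one link, endpoints
  in the same half need two around an interruption of the path.\<close>

lemma ham_proper_words_Suc:
  assumes "n \<ge> 3" "u \<in> proper_words (Suc n)" "v \<in> proper_words (Suc n)" "u \<noteq> v"
  shows "ham (adj (rot (Suc n))) (proper_words (Suc n)) u v"
proof -
  let ?R = "adj (rot (Suc n))" and ?C = "complement (Suc n)"
  have sub: "fst u \<subseteq> {..<Suc n}" if "u \<in> proper_words (Suc n)" for u using that by (auto simp: proper_words_def)
  have JH: "nonempty_words n \<subseteq> proper_words (Suc n)" using proper_words_Suc by blast
  have "n \<notin> fst u" "n \<in> fst (?C u)" if "u \<in> nonempty_words n" for u using that by (auto simp: nonempty_words_def complement_def)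
  then have disj: "nonempty_words n \<inter> ?C ` nonempty_words n = {}" by blast
  have hamJ: "ham ?R (nonempty_words n) u v" if "u \<in> nonempty_words n" "v \<in> nonempty_words n" "u \<noteq> v" for u v
  proof (rule ham_mono[OF ham_nonempty_words[OF \<open>n \<ge> 3\<close> that]])
    fix u v assume uv: "u \<in> nonempty_words n" "v \<in> nonempty_words n" "adj Suc u v"
    \<comment> \<open>The index \<open>n\<close> does not occur in this half, so the rotation never
      wraps around.\<close>
    have "rot (Suc n) ` x = Suc ` x" if "x \<subseteq> {..<n}" for x
      using that by (intro image_cong) (auto simp: rot_def)
    then have "shift (rot (Suc n)) a (fst u) = shift Suc a (fst u)" if "u \<in> nonempty_words n" for u a
      using that by (simp add: shift_def nonempty_words_def mem_Times_iff)
    then show "?R u v" using uv by (simp add: adj_def)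
  qed
  have hamC: "ham ?R (?C ` nonempty_words n) (?C u) (?C v)" if "u \<in> nonempty_words n" "v \<in> nonempty_words n" "u \<noteq> v" for u v
    by (rule ham_map[OF hamJ[OF that] inj_on_subset[OF inj_on_complement JH]])
      (use JH sub in \<open>blast intro: adj_complement\<close>)
  \<comment> \<open>Only the full set \<open>{..<n}\<close> has no link: adding \<open>n\<close> to
    it would give the excluded word \<open>{..<Suc n}\<close>.\<close>
  have link: "?R (x, a) (?C ({..<n} - x, a))" "({..<n} - x, a) \<in> nonempty_words n"
    if "x \<subseteq> {..<n}" "x \<noteq> {..<n}" for x a
  proof -
    have "?C ({..<n} - x, a) = (insert n x, a)" using that(1) by (auto simp: complement_def)
    moreover have "?R (x, a) (insert n x, a)"
      using that by (intro adj_insert inj_on_subset[OF inj_on_rot]) auto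
    ultimately show "?R (x, a) (?C ({..<n} - x, a))" by simp
    show "({..<n} - x, a) \<in> nonempty_words n" using that by (auto simp: nonempty_words_def)
  qed
  have main: "ham ?R (proper_words (Suc n)) u v" if u: "u \<in> nonempty_words n" and v: "v \<in> proper_words (Suc n)" "u \<noteq> v" for u v
  proof (cases "v \<in> nonempty_words n")
    case True
    obtain p where p: "p \<noteq> []" "hd p = u" "last p = v" "distinct p" "set p = nonempty_words n" "successively ?R p"
      using hamJ[OF u True \<open>u \<noteq> v\<close>] unfolding ham_def by blast
    \<comment> \<open>Six vertices ensure an edge of the path that avoids the full set in both
      copies, so both its ends have links.\<close>
    have "length p \<ge> 6" using card_nonempty_words_ge[OF \<open>n \<ge> 3\<close>] p by (metis distinct_card)
    then obtain ps z w qs where pq: "p = ps @ z # w # qs"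
      and "z \<notin> {({..<n}, True), ({..<n}, False)}" "w \<notin> {({..<n}, True), ({..<n}, False)}"
      using ex_adjacent_avoiding[OF p(4)] by blast
    then have z: "fst z \<noteq> {..<n}" "fst w \<noteq> {..<n}" by (metis (full_types) insertCI prod.collapse)+
    have zw: "z \<in> nonempty_words n" "w \<in> nonempty_words n" "z \<noteq> w" using p pq by auto
    then have zwn: "fst z \<subseteq> {..<n}" "fst w \<subseteq> {..<n}" by (auto simp: nonempty_words_def)
    have "ham ?R (nonempty_words n \<union> ?C ` nonempty_words n) u v"
    proof (rule ham_detour[OF _ _ _ _ _ hamC[OF link(2) link(2)] _ _ disj])
      show "?R z (?C ({..<n} - fst z, snd z))" "?R (?C ({..<n} - fst w, snd w)) w"
        using link(1)[OF zwn(1) z(1), of "snd z"] link(1)[OF zwn(2) z(2), of "snd w"]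
        by (auto intro: sympD[OF symp_adj])
      show "({..<n} - fst z, snd z) \<noteq> ({..<n} - fst w, snd w)"
        using zw(3) zwn by (metis double_diff order_refl prod.inject prod.collapse)
    qed (use p pq z zwn in auto)
    then show ?thesis using proper_words_Suc by simp
  next
    case False
    \<comment> \<open>Three singletons are available for the crossing; \<open>u\<close> excludes at
      most one and \<open>v\<close> at most one.\<close>
    have "\<exists>i\<le>2. ({i}, True) \<noteq> u \<and> ?C ({..<n} - {i}, True) \<noteq> v"
    proof (rule ccontr)
      assume "\<not> ?thesis"
      then have *: "({i}, True) = u \<or> ?C ({..<n} - {i}, True) = v" if "i \<le> 2" for i
        using that by blast
      have "fst (?C ({..<n} - {i}, True)) = insert n {i}" if "i \<le> 2" for i
        using that \<open>n \<ge> 3\<close> by (auto simp: complement_def)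
      with * have **: "{i} = fst u \<or> insert n {i} = fst v" if "i \<le> 2" for i
        using that by (metis fst_conv)
      have "{0} \<noteq> {1 :: nat}" "{0} \<noteq> {2 :: nat}" "{1} \<noteq> {2 :: nat}"
        "insert n {0} \<noteq> insert n {1}" "insert n {0} \<noteq> insert n {2}" "insert n {1} \<noteq> insert n {2}"
        using \<open>n \<ge> 3\<close> by (simp_all add: doubleton_eq_iff)
      with **[of 0] **[of 1] **[of 2] show False by (metis le0 one_le_numeral order_refl)
    qed
    then obtain i where i: "i \<le> 2" "({i}, True) \<noteq> u" "?C ({..<n} - {i}, True) \<noteq> v" by blast
    define x where "x = {i}"
    note x = i[folded x_def]
    have "card x \<noteq> card {..<n}" using \<open>n \<ge> 3\<close> by (simp add: x_def)
    then have "x \<noteq> {..<n}" by metis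
    moreover have "x \<subseteq> {..<n}" using \<open>n \<ge> 3\<close> i(1) by (simp add: x_def)
    ultimately have xn: "x \<subseteq> {..<n}" "x \<noteq> {..<n}" "(x, True) \<in> nonempty_words n" by (simp_all add: nonempty_words_def x_def)
    from False v proper_words_Suc obtain v' where v': "v = ?C v'" "v' \<in> nonempty_words n" by blast
    have "ham ?R (?C ` nonempty_words n) (?C ({..<n} - x, True)) v"
      unfolding v'(1) using x(3) v' by (intro hamC link xn) auto
    then show ?thesis
      using ham_join[OF hamJ[OF u xn(3) x(2)[symmetric]] _ link(1)[OF xn(1,2)] disj] proper_words_Suc by simp
  qed
  show ?thesis
  proof (cases "u \<in> nonempty_words n")
    case True then show ?thesis using main assms by blast
  next
    case False
    with assms proper_words_Suc obtain u' where u': "u = ?C u'" "u' \<in> nonempty_words n" by blast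
    \<comment> \<open>Complementing both endpoints brings the first one into the half treated by
      \<open>main\<close>.\<close>
    have "ham ?R (proper_words (Suc n)) u' (?C v)"
      using u' assms complement_in_proper_words[OF assms(3)] complement_complement[OF assms(3)] by (intro main) metis+
    then have "ham ?R (?C ` proper_words (Suc n)) (?C u') (?C (?C v))"
      by (rule ham_map[OF _ inj_on_complement]) (rule adj_complement[OF sub sub])
    then show ?thesis using u' assms complement_complement complement_proper_words by simp
  qed
qed

lemma ham_proper_words:
  assumes "n \<ge> 3" "u \<in> proper_words n" "v \<in> proper_words n" "u \<noteq> v"
  shows "ham (adj (rot n)) (proper_words n) u v"
proof (cases "n = 3")
  case True
  have "proper_words 3 = code_word ` {2..<14}" using codes_proper_words by (simp only: proper_words_def)
  moreover have "inj_on code_word {2..<14}" by (rule inj_on_subset[OF inj_on_code]) auto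
  ultimately show ?thesis
    using ham_connected_by_witnesses[OF certifies_proper adj_proper_edges symp_adj] assms True by metis
next
  case False
  with assms(1) obtain m where "n = Suc m" "m \<ge> 3" by (cases n) auto
  then show ?thesis using ham_proper_words_Suc assms by blast
qed

section \<open>Base-cobases of the wheel\<close>

text \<open>Reducing the index modulo \<open>n\<close> allows arcs to be written
  \<open>m, m + 1, ...\<close> across the point where the numbering wraps.\<close>

definition rim :: "nat \<Rightarrow> nat \<Rightarrow> wheel_vertex set" where
  "rim n k = {Rim (k mod n), Rim (Suc k mod n)}"

definition spoke :: "nat \<Rightarrow> nat \<Rightarrow> wheel_vertex set" where
  "spoke n k = {Hub, Rim (k mod n)}"

lemma edges_wheel: "edges (wheel_graph n) = rim n ` {..<n} \<union> spoke n ` {..<n}"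
  unfolding wheel_graph_def edges_def rim_def spoke_def by (auto simp: image_def)

lemma rim_mod: "rim n (k mod n) = rim n k" and spoke_mod: "spoke n (k mod n) = spoke n k"
  by (simp_all add: rim_def spoke_def mod_Suc_eq)

lemma rim_neq_spoke: "rim n i \<noteq> spoke n j" "spoke n j \<noteq> rim n i"
  by (auto simp: rim_def spoke_def)

lemma inj_on_spoke: "inj_on (spoke n) {..<n}"
  by (auto simp: inj_on_def spoke_def doubleton_eq_iff)

lemma inj_on_rim:
  assumes "n \<ge> 3"
  shows "inj_on (rim n) {..<n}"
proof (rule inj_onI)
  fix i j assume ij: "i \<in> {..<n}" "j \<in> {..<n}" "rim n i = rim n j"
  show "i = j"
  proof (rule ccontr)
    assume "i \<noteq> j"
    \<comment> \<open>Each index would be the cyclic successor of the other, impossible for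
      \<open>n \<ge> 3\<close>.\<close>
    with ij have "i = Suc j mod n" "j = Suc i mod n" by (auto simp: rim_def doubleton_eq_iff)
    moreover have "Suc k mod n = (if Suc k = n then 0 else Suc k)" if "k < n" for k
      using that by (simp add: mod_Suc)
    ultimately have "i = (if Suc j = n then 0 else Suc j)" "j = (if Suc i = n then 0 else Suc i)"
      using ij(1,2) by (metis lessThan_iff)+
    then show False using assms by presburger
  qed
qed

section \<open>Cycles and acyclic edge sets of the wheel\<close>

lemma hub_cycle:
  assumes "1 \<le> l" "l < n" "spoke n m \<in> F" "spoke n (m + l) \<in> F"
    and rims: "\<And>i. i < l \<Longrightarrow> rim n (m + i) \<in> F"
  shows "\<not> acyclic_edges F"
proof -
  \<comment> \<open>The rim arc from \<open>m\<close> to \<open>m + l\<close>, closed through the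
    hub by the two spokes; \<open>l < n\<close> keeps its vertices distinct.\<close>
  define vs where "vs = map (\<lambda>i. Rim ((m + i) mod n)) [0..<Suc l]"
  have "inj_on (\<lambda>i. Rim ((m + i) mod n)) {..<n}"
  proof (rule inj_onI)
    fix i j assume ij: "i \<in> {..<n}" "j \<in> {..<n}" and "Rim ((m + i) mod n) = Rim ((m + j) mod n)"
    then have "(m + i) mod n = (m + j) mod n" by blast
    with ij show "i = j"
    proof (induction i j rule: linorder_wlog)
      case (le i j)
      then have "n dvd (m + j) - (m + i)" by (intro mod_eq_dvd_iff_nat[THEN iffD1]) auto
      then show ?case using le by (auto dest: dvd_imp_le)
    qed auto
  qed
  then have "inj_on (\<lambda>i. Rim ((m + i) mod n)) {0..<Suc l}"
    by (rule inj_on_subset) (use \<open>l < n\<close> in auto)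
  then have dist: "distinct vs" unfolding vs_def distinct_map by (metis distinct_upt set_upt)
  have nth: "vs ! i = Rim ((m + i) mod n)" if "i < Suc l" for i
    using that unfolding vs_def by (subst nth_map) (simp_all del: upt_Suc)
  have len: "length vs = Suc l" by (simp add: vs_def)
  then have "vs \<noteq> []" by auto
  then have vs: "vs \<noteq> []" "hd vs = Rim (m mod n)" "last vs = Rim ((m + l) mod n)"
    using nth[of 0] nth[of l] len by (simp_all add: hd_conv_nth last_conv_nth)
  have "successively (\<lambda>x y. {x, y} \<in> F) vs"
    unfolding successively_conv_nth len
  proof (intro allI impI)
    fix i assume "Suc i < Suc l"
    then show "{vs ! i, vs ! Suc i} \<in> F" using rims[of i] nth[of i] nth[of "Suc i"] by (simp add: rim_def)
  qed
  moreover have "Hub \<notin> set vs" by (auto simp: vs_def)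
  ultimately have "is_cycle F (Hub # vs)"
    using vs len dist assms by (simp add: is_cycle_def successively_Cons spoke_def insert_commute)
  then show ?thesis unfolding acyclic_edges_def by blast
qed

lemma rim_cycle:
  assumes "n \<ge> 3" "\<And>i. i < n \<Longrightarrow> rim n i \<in> F"
  shows "\<not> acyclic_edges F"
proof -
  define vs where "vs = map Rim [0..<n]"
  have s: "successively (\<lambda>x y. {x, y} \<in> F) vs"
    unfolding successively_conv_nth
  proof (intro allI impI)
    fix i assume "Suc i < length vs"
    then have "Suc i < n" by (simp add: vs_def)
    then show "{vs ! i, vs ! Suc i} \<in> F" using assms(2)[of i] by (simp add: rim_def vs_def)
  qed
  have "hd vs = Rim 0" "last vs = Rim (n - 1)" "length vs = n" "distinct vs"
    using assms by (simp_all add: vs_def hd_map last_map distinct_map inj_on_def)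
  moreover have "{Rim (n - 1), Rim 0} \<in> F" using assms(2)[of "n - 1"] assms(1) by (simp add: rim_def)
  ultimately have "is_cycle F vs" using s assms by (simp add: is_cycle_def)
  then show ?thesis unfolding acyclic_edges_def by blast
qed

text \<open>A vertex of maximal rank on a cycle would have two different parents.\<close>

lemma acyclic_if_rooted:
  fixes r :: "'v \<Rightarrow> nat"
  assumes F: "\<And>e. e \<in> F \<Longrightarrow> \<exists>v w. e = {v, w} \<and> (v, w) \<in> P"
    and P: "\<And>v w. (v, w) \<in> P \<Longrightarrow> r w < r v"
      "\<And>v w w'. (v, w) \<in> P \<Longrightarrow> (v, w') \<in> P \<Longrightarrow> w = w'"
  shows "acyclic_edges F"
  unfolding acyclic_edges_def
proof
  assume "\<exists>vs. is_cycle F vs"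
  then obtain vs where vs: "is_cycle F vs" by blast
  define L where "L = length vs"
  have L: "L \<ge> 3" and dist: "distinct vs" using vs by (auto simp: is_cycle_def L_def)
  have edge: "{vs ! k, vs ! (Suc k mod L)} \<in> F" if "k < L" for k
  proof (cases "Suc k = L")
    case True
    then have "vs \<noteq> []" "length vs - 1 = k" by (auto simp: L_def)
    then show ?thesis using vs True
      by (auto simp: is_cycle_def last_conv_nth hd_conv_nth)
  next
    case False
    then show ?thesis using vs that
      by (auto simp: is_cycle_def L_def successively_conv_nth)
  qed
  obtain k where k: "k < L" and max: "\<And>j. j < L \<Longrightarrow> r (vs ! j) \<le> r (vs ! k)"
  proof -
    have "finite (r ` set vs)" "r ` set vs \<noteq> {}" using L L_def by auto
    from Max_in[OF this] obtain v where "v \<in> set vs" "r v = Max (r ` set vs)" by auto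
    moreover from this obtain k where "k < L" "v = vs ! k" by (auto simp: in_set_conv_nth L_def)
    ultimately show ?thesis using that[of k] by (simp add: L_def)
  qed
  have parent: "(vs ! k, vs ! j) \<in> P" if j: "j < L" "{vs ! k, vs ! j} \<in> F" for j
  proof -
    obtain v w where "{vs ! k, vs ! j} = {v, w}" "(v, w) \<in> P" using F[OF j(2)] by blast
    then show ?thesis using P(1)[of v w] max[OF j(1)] by (auto simp: doubleton_eq_iff)
  qed
  \<comment> \<open>The cyclic predecessor of \<open>k\<close>, distinct from the successor because
    the cycle has length at least 3.\<close>
  define i where "i = (if k = 0 then L - 1 else k - 1)"
  have i: "i < L" "Suc i mod L = k" "Suc k mod L \<noteq> i" "Suc k mod L < L"
    using k L by (auto simp: i_def mod_Suc)
  have "(vs ! k, vs ! i) \<in> P" "(vs ! k, vs ! (Suc k mod L)) \<in> P"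
    using parent[of i] parent[of "Suc k mod L"] edge[of i] edge[of k] i k by (auto simp: insert_commute)
  then have "vs ! i = vs ! (Suc k mod L)" using P(2) by blast
  then show False using i dist by (simp add: nth_eq_iff_index_eq L_def)
qed

text \<open>\<open>s\<close> collects the missing spokes, so that complementing the edge set
  complements both \<open>x\<close> and \<open>s\<close>.\<close>

definition wheel_tree :: "nat \<Rightarrow> nat set \<Rightarrow> nat set \<Rightarrow> wheel_vertex set set" where
  "wheel_tree n x s = rim n ` x \<union> spoke n ` ({..<n} - s)"

lemma rim_in_tree:
  assumes "n \<ge> 3" "x \<subseteq> {..<n}"
  shows "rim n k \<in> wheel_tree n x s \<longleftrightarrow> k mod n \<in> x"
proof -
  have "rim n k \<in> wheel_tree n x s \<longleftrightarrow> rim n (k mod n) \<in> rim n ` x"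
    unfolding wheel_tree_def rim_mod using rim_neq_spoke by blast
  then show ?thesis
    using inj_on_image_mem_iff[OF inj_on_rim[OF assms(1)] _ assms(2), of "k mod n"] assms(1) by simp
qed

lemma spoke_in_tree:
  assumes "n \<ge> 3"
  shows "spoke n k \<in> wheel_tree n x s \<longleftrightarrow> k mod n \<notin> s"
proof -
  have "spoke n k \<in> wheel_tree n x s \<longleftrightarrow> spoke n (k mod n) \<in> spoke n ` ({..<n} - s)"
    unfolding wheel_tree_def spoke_mod using rim_neq_spoke by blast
  then show ?thesis
    using inj_on_image_mem_iff[OF inj_on_spoke[of n], of "k mod n" "{..<n} - s"] assms by simp
qed

lemma wheel_tree_subset: "x \<subseteq> {..<n} \<Longrightarrow> wheel_tree n x s \<subseteq> edges (wheel_graph n)"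
  by (auto simp: wheel_tree_def edges_wheel)

lemma edge_set_eqI:
  assumes "A \<subseteq> edges (wheel_graph n)" "B \<subseteq> edges (wheel_graph n)"
    and "\<And>i. i < n \<Longrightarrow> rim n i \<in> A \<longleftrightarrow> rim n i \<in> B" "\<And>i. i < n \<Longrightarrow> spoke n i \<in> A \<longleftrightarrow> spoke n i \<in> B"
  shows "A = B"
proof (rule set_eqI)
  fix e
  show "e \<in> A \<longleftrightarrow> e \<in> B"
  proof (cases "e \<in> edges (wheel_graph n)")
    case True
    then consider i where "i < n" "e = rim n i" | i where "i < n" "e = spoke n i"
      unfolding edges_wheel by auto
    then show ?thesis using assms(3,4) by cases auto
  qed (use assms(1,2) in auto)
qed

lemma edges_diff_tree:
  assumes "n \<ge> 3" "x \<subseteq> {..<n}" "s \<subseteq> {..<n}"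
  shows "edges (wheel_graph n) - wheel_tree n x s = wheel_tree n ({..<n} - x) ({..<n} - s)"
proof (rule edge_set_eqI)
  show "wheel_tree n ({..<n} - x) ({..<n} - s) \<subseteq> edges (wheel_graph n)" by (rule wheel_tree_subset) auto
  fix i assume "i < n"
  then show "rim n i \<in> edges (wheel_graph n) - wheel_tree n x s \<longleftrightarrow> rim n i \<in> wheel_tree n ({..<n} - x) ({..<n} - s)"
    "spoke n i \<in> edges (wheel_graph n) - wheel_tree n x s \<longleftrightarrow> spoke n i \<in> wheel_tree n ({..<n} - x) ({..<n} - s)"
    using assms by (auto simp: rim_in_tree spoke_in_tree edges_wheel)
qed auto

text \<open>The tree is rooted at the hub: a rim vertex in \<open>x\<close> has its cyclic successor
  as parent, any other one the hub. The gap at \<open>c\<close> makes a rank possible.\<close>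

lemma acyclic_tree:
  assumes x: "x \<subseteq> {..<n}" and c: "c < n" "c \<notin> x"
  shows "acyclic_edges (wheel_tree n x x)"
proof (rule acyclic_if_rooted)
  let ?P = "{(Rim i, Rim (Suc i mod n)) | i. i \<in> x} \<union> {(Rim i, Hub) | i. i < n \<and> i \<notin> x}"
  \<comment> \<open>The number of forward steps from \<open>i\<close> to \<open>c\<close>.\<close>
  define d where "d i = (if i \<le> c then c - i else c + n - i)" for i
  define r where "r v = (case v of Hub \<Rightarrow> 0 | Rim i \<Rightarrow> Suc (d i))" for v
  show "\<exists>v w. e = {v, w} \<and> (v, w) \<in> ?P" if "e \<in> wheel_tree n x x" for e
  proof -
    from that x consider i where "i \<in> x" "e = {Rim i, Rim (Suc i mod n)}"
      | i where "i < n" "i \<notin> x" "e = {Rim i, Hub}"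
      by (auto simp: wheel_tree_def rim_def spoke_def insert_commute)
    then show ?thesis by cases blast+
  qed
  have d: "d (Suc i mod n) < d i" if "i < n" "i \<noteq> c" for i
    using that c by (auto simp: d_def mod_Suc)
  show "r w < r v" if "(v, w) \<in> ?P" for v w
    using that x c by (auto simp: r_def intro!: d)
  show "w = w'" if "(v, w) \<in> ?P" "(v, w') \<in> ?P" for v w w'
    using that by auto
qed

text \<open>The mirror image: rim edge \<open>i\<close> now leads from the child
  \<open>rot n i\<close> to its parent \<open>i\<close>, and injectivity of the rotation makes
  parents unique.\<close>

lemma acyclic_tree_rot:
  assumes x: "x \<subseteq> {..<n}" and c: "c < n" "c \<notin> x"
  shows "acyclic_edges (wheel_tree n x (rot n ` x))"
proof (rule acyclic_if_rooted)
  let ?P = "{(Rim (rot n i), Rim i) | i. i \<in> x} \<union> {(Rim i, Hub) | i. i < n \<and> i \<notin> rot n ` x}"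
  \<comment> \<open>The number of forward steps from the successor of \<open>c\<close> to
    \<open>i\<close>.\<close>
  define d where "d i = (if c < i then i - Suc c else i + n - Suc c)" for i
  define r where "r v = (case v of Hub \<Rightarrow> 0 | Rim i \<Rightarrow> Suc (d i))" for v
  show "\<exists>v w. e = {v, w} \<and> (v, w) \<in> ?P" if "e \<in> wheel_tree n x (rot n ` x)" for e
  proof -
    from that x consider i where "i \<in> x" "e = {Rim (rot n i), Rim i}"
      | i where "i < n" "i \<notin> rot n ` x" "e = {Rim i, Hub}"
      by (auto simp: wheel_tree_def rim_def spoke_def insert_commute rot_def)
    then show ?thesis by cases blast+
  qed
  have d: "d i < d (rot n i)" if "i < n" "i \<noteq> c" for i
    using that c by (auto simp: d_def rot_def mod_Suc)
  show "r w < r v" if "(v, w) \<in> ?P" for v w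
    using that x c by (auto simp: r_def intro!: d)
  show "w = w'" if "(v, w) \<in> ?P" "(v, w') \<in> ?P" for v w w'
    using that x inj_onD[OF inj_on_rot[of n]] by auto
qed

section \<open>Maximality of the two kinds of trees\<close>

lemma ex_forward_distance:
  fixes i j n :: nat
  assumes "i < n" "j < n" "i \<noteq> j"
  obtains l where "1 \<le> l" "l < n" "(j + l) mod n = i"
proof (cases "i < j")
  case True then show ?thesis using assms by (intro that[of "i + n - j"]) auto
next
  case False then show ?thesis using assms by (intro that[of "i - j"]) auto
qed

lemma ex_backward_distance:
  fixes i j n :: nat
  assumes "i < n" "j < n" "i \<noteq> j"
  obtains l where "1 \<le> l" "l < n" "(j + n - l) mod n = i"
proof (cases "i < j")
  case True then show ?thesis using assms by (intro that[of "j - i"]) auto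
next
  case False then show ?thesis using assms by (intro that[of "j + n - i"]) auto
qed

text \<open>The tree has exactly one of \<open>rim n j\<close> and \<open>spoke n j\<close> for each
  \<open>j\<close>, so it suffices that \<open>F\<close> never has both. If it did, walking forward
  from \<open>j\<close> would either reach a first index outside \<open>x\<close>, whose spoke
  closes a cycle through the hub, or complete the rim cycle.\<close>

lemma wheel_tree_maximal:
  assumes n: "n \<ge> 3" and x: "x \<subseteq> {..<n}"
    and F: "wheel_tree n x x \<subseteq> F" "F \<subseteq> edges (wheel_graph n)" "acyclic_edges F"
  shows "F = wheel_tree n x x"
proof -
  have rimF: "rim n k \<in> F" if "k mod n \<in> x" for k using F(1) rim_in_tree[OF n x] that by blast
  have spokeF: "spoke n k \<in> F" if "k mod n \<notin> x" for k using F(1) spoke_in_tree[OF n] that by blast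
  have *: False if j: "j < n" "rim n j \<in> F" "spoke n j \<in> F" for j
  proof (cases "\<exists>l. 1 \<le> l \<and> l < n \<and> (j + l) mod n \<notin> x")
    case True
    define l where "l = (LEAST l. 1 \<le> l \<and> l < n \<and> (j + l) mod n \<notin> x)"
    have l: "1 \<le> l" "l < n" "(j + l) mod n \<notin> x"
      using LeastI_ex[OF True] by (simp_all add: l_def)
    have "(j + i) mod n \<in> x" if "1 \<le> i" "i < l" for i
      using not_less_Least[of i "\<lambda>l. 1 \<le> l \<and> l < n \<and> (j + l) mod n \<notin> x"] that l(2) by (simp add: l_def)
    then have "rim n (j + i) \<in> F" if "i < l" for i
      using that j(2) rimF by (cases "i = 0") auto
    then show False using hub_cycle[OF l(1,2) j(3) spokeF[OF l(3)]] F(3) by blast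
  next
    case False
    have "rim n i \<in> F" if "i < n" for i
    proof (cases "i = j")
      case neq: False
      from ex_forward_distance[OF \<open>i < n\<close> \<open>j < n\<close> neq] False have "i \<in> x" by metis
      then show ?thesis using rimF[of i] that by simp
    qed (use j in simp)
    then show False using rim_cycle[OF n] F(3) by blast
  qed
  show ?thesis
  proof (rule edge_set_eqI[OF F(2) wheel_tree_subset[OF x]])
    fix i assume "i < n"
    then show "rim n i \<in> F \<longleftrightarrow> rim n i \<in> wheel_tree n x x" "spoke n i \<in> F \<longleftrightarrow> spoke n i \<in> wheel_tree n x x"
      using *[of i] rimF[of i] spokeF[of i] by (auto simp: rim_in_tree[OF n x] spoke_in_tree[OF n])
  qed
qed

text \<open>The same argument walking backwards, with \<open>rim n j\<close> paired with the spoke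
  at its other end \<open>Suc j\<close>.\<close>

lemma wheel_tree_rot_maximal:
  assumes n: "n \<ge> 3" and x: "x \<subseteq> {..<n}"
    and F: "wheel_tree n x (rot n ` x) \<subseteq> F" "F \<subseteq> edges (wheel_graph n)" "acyclic_edges F"
  shows "F = wheel_tree n x (rot n ` x)"
proof -
  have rot_mem: "Suc k mod n \<in> rot n ` x \<longleftrightarrow> k mod n \<in> x" for k
    using inj_on_image_mem_iff[OF inj_on_rot[of n] _ x, of "k mod n"] n by (simp add: rot_def mod_Suc_eq)
  have rimF: "rim n k \<in> F" if "k mod n \<in> x" for k using F(1) rim_in_tree[OF n x] that by blast
  have spokeF: "spoke n (Suc k) \<in> F" if "k mod n \<notin> x" for k
    using F(1) spoke_in_tree[OF n] that rot_mem by blast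
  have *: False if j: "j < n" "rim n j \<in> F" "spoke n (Suc j) \<in> F" for j
  proof (cases "\<exists>l. 1 \<le> l \<and> l < n \<and> (j + n - l) mod n \<notin> x")
    case True
    define l where "l = (LEAST l. 1 \<le> l \<and> l < n \<and> (j + n - l) mod n \<notin> x)"
    have l: "1 \<le> l" "l < n" "(j + n - l) mod n \<notin> x"
      using LeastI_ex[OF True] by (simp_all add: l_def)
    have inx: "(j + n - i) mod n \<in> x" if "1 \<le> i" "i < l" for i
      using not_less_Least[of i "\<lambda>l. 1 \<le> l \<and> l < n \<and> (j + n - l) mod n \<notin> x"] that l(2) by (simp add: l_def)
    \<comment> \<open>The arc starts one past the index outside \<open>x\<close>, where the spoke is
      present, and ends at \<open>Suc j\<close>. The summand \<open>n\<close> keeps the subtraction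
      from truncating.\<close>
    let ?m = "Suc (j + n - l)"
    have "rim n (?m + i) \<in> F" if "i < l" for i
    proof (cases "Suc i = l")
      case True
      then have "?m + i = j + n" using l by simp
      then have "rim n (?m + i) = rim n j" using rim_mod[of n "j + n"] rim_mod[of n j] by simp
      then show ?thesis using j by simp
    next
      case False
      then have eq: "?m + i = j + n - (l - Suc i)" using l that by simp
      show ?thesis unfolding eq by (rule rimF, rule inx) (use that False in auto)
    qed
    moreover have "spoke n (?m + l) \<in> F"
    proof -
      have "?m + l = Suc j + n" using l by simp
      then have "spoke n (?m + l) = spoke n (Suc j)" by (simp only: spoke_def mod_add_self2)
      then show ?thesis using j by simp
    qed
    ultimately show False using hub_cycle[OF l(1,2) spokeF[OF l(3)]] F(3) by blast
  next
    case False
    have "rim n i \<in> F" if "i < n" for i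
    proof (cases "i = j")
      case neq: False
      from ex_backward_distance[OF \<open>i < n\<close> \<open>j < n\<close> neq] False have "i \<in> x" by metis
      then show ?thesis using rimF[of i] that by simp
    qed (use j in simp)
    then show False using rim_cycle[OF n] F(3) by blast
  qed
  show ?thesis
  proof (rule edge_set_eqI[OF F(2) wheel_tree_subset[OF x]])
    fix i assume i: "i < n"
    then show "rim n i \<in> F \<longleftrightarrow> rim n i \<in> wheel_tree n x (rot n ` x)"
      using *[of i] rimF[of i] spokeF[of i] by (auto simp: rim_in_tree[OF n x])
    from i obtain k where k: "k < n" "i = rot n k" using rot_image[of n] by auto
    then have "spoke n i = spoke n (Suc k)" by (simp add: rot_def spoke_mod)
    then show "spoke n i \<in> F \<longleftrightarrow> spoke n i \<in> wheel_tree n x (rot n ` x)"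
      using *[OF k(1)] rimF[of k] spokeF[of k] k(1) by (auto simp: spoke_in_tree[OF n] rot_mem)
  qed
qed

section \<open>The base-cobases are exactly the trees of proper words\<close>

lemma base_iff:
  "B \<in> bases (graphic_matroid G) \<longleftrightarrow> B \<subseteq> edges G \<and> acyclic_edges B \<and>
    (\<forall>F. B \<subseteq> F \<and> F \<subseteq> edges G \<and> acyclic_edges F \<longrightarrow> F = B)"
  by (simp add: bases_def graphic_matroid_def)

lemma wheel_tree_base:
  assumes "n \<ge> 3" "x \<subset> {..<n}"
  shows "wheel_tree n x (shift (rot n) a x) \<in> bases (graphic_matroid (wheel_graph n))"
proof -
  have x: "x \<subseteq> {..<n}" using assms by blast
  obtain c where "c < n" "c \<notin> x" using assms by blast
  then show ?thesis
    unfolding base_iff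
    using wheel_tree_subset[OF x] acyclic_tree[OF x] acyclic_tree_rot[OF x] wheel_tree_maximal[OF assms(1) x]
      wheel_tree_rot_maximal[OF assms(1) x] by (cases a) (simp_all add: shift_def)
qed

text \<open>The complementary edge set is again such a tree, with the complementary rim set and the
  same \<open>a\<close>.\<close>

lemma tree_shift_base_cobase:
  assumes "n \<ge> 3" "x \<subset> {..<n}" "x \<noteq> {}"
  shows "wheel_tree n x (shift (rot n) a x) \<in> base_cobases (graphic_matroid (wheel_graph n))"
proof -
  have x: "x \<subseteq> {..<n}" and x': "{..<n} - x \<subset> {..<n}" using assms by blast+
  have "ground (graphic_matroid (wheel_graph n)) - wheel_tree n x (shift (rot n) a x) =
      wheel_tree n ({..<n} - x) (shift (rot n) a ({..<n} - x))"
    using edges_diff_tree[OF assms(1) x shift_rot_subset[OF x]] shift_rot_diff[OF x]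
    by (simp add: ground_def graphic_matroid_def)
  then show ?thesis
    using wheel_tree_base[OF assms(1,2)] wheel_tree_base[OF assms(1) x'] by (simp add: base_cobases_def)
qed

text \<open>Walking around the rim: once \<open>t\<close> disagrees with \<open>e\<close> at some index \<open>m\<close>, the maximal run of \<open>e\<close>
  through \<open>m\<close> admits no second disagreement, so its last vertex agrees with it and is therefore a
  disagreement with the following run.\<close>

lemma shifted_after_disagreement:
  fixes e t :: "nat \<Rightarrow> bool"
  assumes run: "\<And>m l c. 1 \<le> l \<Longrightarrow> l < n \<Longrightarrow> (\<forall>i<l. e (m + i) = c) \<Longrightarrow> t m \<noteq> c \<Longrightarrow> t (m + l) = c"
    and bound: "\<And>m c. \<exists>i<n. e (m + i) \<noteq> c"
    and dis: "t j \<noteq> e j" and "j \<le> k"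
  shows "t (Suc k) = e k"
proof -
  \<comment> \<open>By \<open>bound\<close> a constant stretch of \<open>e\<close> is shorter than
    \<open>n\<close>, so \<open>run\<close> applies.\<close>
  have next_eq: "t (m + l) = e m"
    if "1 \<le> l" "\<forall>i<l. e (m + i) = e m" "t m \<noteq> e m" for m l
  proof (rule run[OF that(1) _ that(2,3)])
    obtain i where "i < n" "e (m + i) \<noteq> e m" using bound by blast
    moreover from this that(2) have "\<not> i < l" by blast
    ultimately show "l < n" by simp
  qed
  \<comment> \<open>Invariant: \<open>k\<close> is the last index so far of a constant stretch of
    \<open>e\<close> that starts at a disagreement \<open>m\<close>.\<close>
  have "\<exists>m l. m + l = Suc k \<and> 1 \<le> l \<and> (\<forall>i<l. e (m + i) = e m) \<and> t m \<noteq> e m"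
    using \<open>j \<le> k\<close>
  proof (induction k rule: dec_induct)
    case base
    show ?case using dis by (intro exI[of _ j] exI[of _ 1]) simp
  next
    case (step k)
    then obtain m l where ml: "m + l = Suc k" "1 \<le> l" "\<forall>i<l. e (m + i) = e m" "t m \<noteq> e m" by blast
    show ?case
    proof (cases "e (Suc k) = e m")
      case True
      then show ?thesis using ml by (intro exI[of _ m] exI[of _ "Suc l"]) (auto simp: less_Suc_eq)
    next
      case False
      then have "t (Suc k) \<noteq> e (Suc k)" using next_eq[OF ml(2-4)] ml(1) by simp
      then show ?thesis by (intro exI[of _ "Suc k"] exI[of _ 1]) simp
    qed
  qed
  then obtain m l where ml: "m + l = Suc k" "1 \<le> l" "\<forall>i<l. e (m + i) = e m" "t m \<noteq> e m" by blast
  then have "t (Suc k) = e m" using next_eq[of l m] by simp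
  moreover have "e (m + (l - 1)) = e m" using ml(3)[rule_format, of "l - 1"] ml(2) by linarith
  moreover have "m + (l - 1) = k" using ml(1,2) by simp
  ultimately show ?thesis by simp
qed

text \<open>Excluding cycles through the hub in \<open>B\<close> and in its complement gives
  \<open>run\<close> for the two values of \<open>c\<close>; excluding the rim cycle gives
  \<open>bound\<close>. So the missing spokes are \<open>x\<close> itself, or one disagreement
  propagates around the rim and they are its rotation.\<close>

lemma base_cobase_is_tree_shift:
  assumes n: "n \<ge> 3" and B: "B \<in> base_cobases (graphic_matroid (wheel_graph n))"
  shows "\<exists>x a. x \<subset> {..<n} \<and> x \<noteq> {} \<and> B = wheel_tree n x (shift (rot n) a x)"
proof -
  let ?E = "edges (wheel_graph n)"
  have Bs: "B \<subseteq> ?E" and acB: "acyclic_edges B" and acC: "acyclic_edges (?E - B)"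
    using B by (simp_all add: base_cobases_def base_iff ground_def graphic_matroid_def bases_def)
  define x where "x = {i. i < n \<and> rim n i \<in> B}"
  define s where "s = {i. i < n \<and> spoke n i \<notin> B}"
  have xs: "x \<subseteq> {..<n}" "s \<subseteq> {..<n}" by (auto simp: x_def s_def)
  have mem: "i \<in> x \<longleftrightarrow> rim n i \<in> B" "i \<in> s \<longleftrightarrow> spoke n i \<notin> B" if "i < n" for i
    using that by (simp_all add: x_def s_def)
  have Beq: "B = wheel_tree n x s"
    by (rule edge_set_eqI[OF Bs wheel_tree_subset[OF xs(1)]])
      (simp_all add: rim_in_tree[OF n xs(1)] spoke_in_tree[OF n] mem)
  have Ceq: "?E - B = wheel_tree n ({..<n} - x) ({..<n} - s)"
    unfolding Beq by (rule edges_diff_tree[OF n xs])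
  have mn: "k mod n < n" for k using n by simp
  \<comment> \<open>Periodic sequences in place of \<open>x\<close> and \<open>s\<close> allow
    walking around the rim without wrapping.\<close>
  define e where "e k \<longleftrightarrow> k mod n \<in> x" for k
  define t where "t k \<longleftrightarrow> k mod n \<in> s" for k
  have inB: "rim n k \<in> B \<longleftrightarrow> e k" "spoke n k \<in> B \<longleftrightarrow> \<not> t k" for k
    unfolding Beq e_def t_def by (simp_all add: rim_in_tree[OF n xs(1)] spoke_in_tree[OF n])
  have inC: "rim n k \<in> ?E - B \<longleftrightarrow> \<not> e k" "spoke n k \<in> ?E - B \<longleftrightarrow> t k" for k
    unfolding Ceq e_def t_def using mn by (simp_all add: rim_in_tree[OF n] spoke_in_tree[OF n])
  have ne: "x \<noteq> {}" "x \<noteq> {..<n}"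
  proof -
    show "x \<noteq> {..<n}"
      using rim_cycle[OF n, of B] acB inB(1) mn by (auto simp: e_def)
    show "x \<noteq> {}"
      using rim_cycle[OF n, of "?E - B"] acC inC(1) by (auto simp: e_def)
  qed
  have run: "t (m + l) = c" if "1 \<le> l" "l < n" "\<forall>i<l. e (m + i) = c" "t m \<noteq> c" for m l c
  proof (rule ccontr)
    assume "t (m + l) \<noteq> c"
    show False
    proof (cases c)
      case True
      then have "\<not> acyclic_edges B"
        using that(3,4) \<open>t (m + l) \<noteq> c\<close> by (intro hub_cycle[OF that(1,2), of m]) (simp_all add: inB)
      then show False using acB by blast
    next
      case False
      then have "\<not> acyclic_edges (?E - B)"
        using that(3,4) \<open>t (m + l) \<noteq> c\<close> by (intro hub_cycle[OF that(1,2), of m]) (simp_all add: inC del: Diff_iff)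
      then show False using acC by blast
    qed
  qed
  have bound: "\<exists>i<n. e (m + i) \<noteq> c" for m c
  proof (rule ccontr)
    assume "\<not> ?thesis"
    then have *: "e (m + i) = c" if "i < n" for i using that by blast
    have "i \<in> x \<longleftrightarrow> c" if "i < n" for i
    proof (cases "i = m mod n")
      case True
      then show ?thesis using *[of 0] n by (simp add: e_def)
    next
      case False
      obtain l where "l < n" "(m mod n + l) mod n = i"
        using ex_forward_distance[OF \<open>i < n\<close> mn[of m] False] by blast
      then show ?thesis using *[of l] by (simp add: e_def mod_add_left_eq)
    qed
    then show False using ne xs(1) by (cases c) auto
  qed
  show ?thesis
  proof (cases "s = x")
    case True
    then show ?thesis using ne xs(1) Beq
      by (intro exI[of _ x] exI[of _ False]) (auto simp: shift_def)
  next
    case False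
    then obtain j where "j < n" "t j \<noteq> e j" using xs by (auto simp: t_def e_def)
    have s_iff: "rot n i \<in> s \<longleftrightarrow> i \<in> x" if "i < n" for i
    proof -
      \<comment> \<open>\<open>i + n\<close> has the residue of \<open>i\<close> and lies beyond the
        disagreement \<open>j\<close>.\<close>
      have "t (Suc (i + n)) = e (i + n)"
        by (rule shifted_after_disagreement[of n e t j, OF run bound \<open>t j \<noteq> e j\<close>])
          (use \<open>j < n\<close> in auto)
      moreover have "Suc (i + n) mod n = rot n i" unfolding rot_def by (metis add_Suc mod_add_self2)
      ultimately show ?thesis using that by (simp add: t_def e_def)
    qed
    have "s = rot n ` x"
    proof
      show "s \<subseteq> rot n ` x"
      proof
        fix r assume "r \<in> s"
        then have "r \<in> rot n ` {..<n}" using xs(2) rot_image[of n] by auto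
        then show "r \<in> rot n ` x" using s_iff \<open>r \<in> s\<close> by auto
      qed
      show "rot n ` x \<subseteq> s" using s_iff xs(1) by auto
    qed
    then show ?thesis using ne xs(1) Beq
      by (intro exI[of _ x] exI[of _ True]) (auto simp: shift_def)
  qed
qed

section \<open>Transfer from words to the base-cobase graph\<close>

lemma rot_closed_eq:
  assumes "x \<subseteq> {..<n}" "x \<noteq> {}" "rot n ` x = x"
  shows "x = {..<n}"
proof -
  obtain i where "i \<in> x" using assms by blast
  have "(i + k) mod n \<in> x" for k
  proof (induction k)
    case 0 then show ?case using \<open>i \<in> x\<close> assms(1) by auto
  next
    case (Suc k)
    then have "rot n ((i + k) mod n) \<in> x" using assms(3) by blast
    then show ?case by (simp add: rot_def mod_Suc_eq)
  qed
  moreover have "\<exists>k. (i + k) mod n = j" if "j < n" for j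
  proof (cases "j = i")
    case True then show ?thesis using that by (intro exI[of _ 0]) simp
  next
    case False
    have "i < n" using \<open>i \<in> x\<close> assms(1) by blast
    from ex_forward_distance[OF that this False] show ?thesis by blast
  qed
  ultimately show ?thesis using assms(1) by (metis lessThan_iff subsetI subset_antisym)
qed

lemma inj_on_tree:
  assumes n: "n \<ge> 3" and "x \<subseteq> {..<n}" "y \<subseteq> {..<n}" "s \<subseteq> {..<n}" "t \<subseteq> {..<n}" "wheel_tree n x s = wheel_tree n y t"
  shows "x = y" "s = t"
proof -
  have "i \<in> x \<longleftrightarrow> i \<in> y" if "i < n" for i
    using rim_in_tree[OF n assms(2), of i s] rim_in_tree[OF n assms(3), of i t] assms(6) that by simp
  then show "x = y" using assms(2,3) by blast
  have "i \<in> s \<longleftrightarrow> i \<in> t" if "i < n" for i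
    using spoke_in_tree[OF n, of i x s] spoke_in_tree[OF n, of i y t] assms(6) that by simp
  then show "s = t" using assms(4,5) by blast
qed

text \<open>Rim edges and spokes are disjoint kinds of edges, so the distance of two trees is the
  sum used in \<open>adj\<close>.\<close>

lemma card_sym_diff_tree:
  assumes n: "n \<ge> 3" and "x \<subseteq> {..<n}" "y \<subseteq> {..<n}" "s \<subseteq> {..<n}" "t \<subseteq> {..<n}"
  shows "card (sym_diff (wheel_tree n x s) (wheel_tree n y t)) = card (sym_diff x y) + card (sym_diff s t)"
proof -
  have xy: "sym_diff x y \<subseteq> {..<n}" "sym_diff s t \<subseteq> {..<n}" using assms by blast+
  have "sym_diff (wheel_tree n x s) (wheel_tree n y t) = rim n ` sym_diff x y \<union> spoke n ` sym_diff s t"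
  proof (rule edge_set_eqI)
    show "sym_diff (wheel_tree n x s) (wheel_tree n y t) \<subseteq> edges (wheel_graph n)"
      using wheel_tree_subset assms(2,3) by blast
    show "rim n ` sym_diff x y \<union> spoke n ` sym_diff s t \<subseteq> edges (wheel_graph n)"
      unfolding edges_wheel using xy by blast
    fix i assume i: "i < n"
    have "rim n i \<in> rim n ` sym_diff x y \<longleftrightarrow> i \<in> sym_diff x y"
      by (rule inj_on_image_mem_iff[OF inj_on_rim[OF n] _ xy(1)]) (use i in simp)
    moreover have "rim n i \<notin> spoke n ` sym_diff s t" using rim_neq_spoke by blast
    ultimately show "rim n i \<in> sym_diff (wheel_tree n x s) (wheel_tree n y t) \<longleftrightarrow>
        rim n i \<in> rim n ` sym_diff x y \<union> spoke n ` sym_diff s t"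
      using i by (simp add: rim_in_tree[OF n] assms)
    have "spoke n i \<in> spoke n ` sym_diff s t \<longleftrightarrow> i \<in> sym_diff s t"
      by (rule inj_on_image_mem_iff[OF inj_on_spoke _ xy(2)]) (use i in simp)
    moreover have "spoke n i \<notin> rim n ` sym_diff x y" using rim_neq_spoke by blast
    ultimately show "spoke n i \<in> sym_diff (wheel_tree n x s) (wheel_tree n y t) \<longleftrightarrow>
        spoke n i \<in> rim n ` sym_diff x y \<union> spoke n ` sym_diff s t"
      using i by (auto simp: spoke_in_tree[OF n])
  qed
  moreover have "card (rim n ` sym_diff x y \<union> spoke n ` sym_diff s t) =
      card (rim n ` sym_diff x y) + card (spoke n ` sym_diff s t)"
    using finite_subset[OF xy(1)] finite_subset[OF xy(2)] rim_neq_spoke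
    by (intro card_Un_disjoint finite_imageI) auto
  ultimately show ?thesis
    using card_image[OF inj_on_subset[OF inj_on_rim[OF n] xy(1)]]
      card_image[OF inj_on_subset[OF inj_on_spoke[of n] xy(2)]] by simp
qed

theorem theorem4p8:
  fixes n :: nat
  assumes "n \<ge> 3"
  shows "hamiltonian_connected (base_cobase_graph (graphic_matroid (wheel_graph n)))"
proof -
  let ?M = "graphic_matroid (wheel_graph n)"
  let ?G = "base_cobase_graph ?M"
  \<comment> \<open>Decoding of words into edge sets; a Hamiltonian path of words is mapped along
    it.\<close>
  define \<phi> where "\<phi> u = wheel_tree n (fst u) (shift (rot n) (snd u) (fst u))" for u
  have sub: "fst u \<subseteq> {..<n}" if "u \<in> proper_words n" for u using that by (auto simp: proper_words_def)
  have img: "\<phi> ` proper_words n = base_cobases ?M"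
  proof
    show "\<phi> ` proper_words n \<subseteq> base_cobases ?M"
    proof (rule image_subsetI)
      fix u assume "u \<in> proper_words n"
      then have "fst u \<subset> {..<n}" "fst u \<noteq> {}" by (auto simp: proper_words_def)
      then show "\<phi> u \<in> base_cobases ?M" unfolding \<phi>_def by (rule tree_shift_base_cobase[OF assms])
    qed
    show "base_cobases ?M \<subseteq> \<phi> ` proper_words n"
    proof
      fix B assume "B \<in> base_cobases ?M"
      then obtain x a where "x \<subset> {..<n}" "x \<noteq> {}" "B = wheel_tree n x (shift (rot n) a x)"
        using base_cobase_is_tree_shift[OF assms] by blast
      then show "B \<in> \<phi> ` proper_words n" by (intro image_eqI[of _ _ "(x, a)"]) (auto simp: \<phi>_def proper_words_def)
    qed
  qed
  have inj: "inj_on \<phi> (proper_words n)"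
  proof (rule inj_onI)
    fix u v assume uv: "u \<in> proper_words n" "v \<in> proper_words n" "\<phi> u = \<phi> v"
    obtain x a y b where [simp]: "u = (x, a)" "v = (y, b)" by force
    have x: "x \<subseteq> {..<n}" "y \<subseteq> {..<n}" "x \<noteq> {}" "x \<noteq> {..<n}" using uv by (auto simp: proper_words_def)
    have "x = y" "shift (rot n) a x = shift (rot n) b y"
      using inj_on_tree[OF assms x(1,2) shift_rot_subset[OF x(1)] shift_rot_subset[OF x(2)]] uv(3)
      by (auto simp: \<phi>_def)
    \<comment> \<open>Only the empty and the full set equal their rotation, so the missing spokes
      determine the copy.\<close>
    moreover have "rot n ` x \<noteq> x" using rot_closed_eq x by blast
    ultimately have "a = b" by (auto simp: shift_def split: if_splits)
    with \<open>x = y\<close> show "u = v" by simp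
  qed
  have adj_edge: "{\<phi> u, \<phi> v} \<in> edges ?G" if "u \<in> proper_words n" "v \<in> proper_words n" "adj (rot n) u v" for u v
  proof -
    have "card (sym_diff (\<phi> u) (\<phi> v)) = 2"
      using that(3) card_sym_diff_tree[OF assms sub[OF that(1)] sub[OF that(2)] shift_rot_subset[OF sub[OF that(1)]]
          shift_rot_subset[OF sub[OF that(2)]]] by (simp add: \<phi>_def adj_def)
    moreover have "\<phi> u \<in> base_cobases ?M" "\<phi> v \<in> base_cobases ?M" using img that by blast+
    ultimately show ?thesis unfolding base_cobase_graph_def edges_def by auto
  qed
  show ?thesis
    unfolding hamiltonian_connected_def
  proof (intro ballI impI)
    fix A B assume AB: "A \<in> verts ?G" "B \<in> verts ?G" "A \<noteq> B"
    have V: "verts ?G = \<phi> ` proper_words n" by (simp add: verts_def base_cobase_graph_def img)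
    obtain u where u: "u \<in> proper_words n" "A = \<phi> u" using AB(1) unfolding V by (rule imageE)
    obtain v where v: "v \<in> proper_words n" "B = \<phi> v" using AB(2) unfolding V by (rule imageE)
    from u v AB(3) have uv: "u \<in> proper_words n" "v \<in> proper_words n" "A = \<phi> u" "B = \<phi> v" "u \<noteq> v" by auto
    have "ham (\<lambda>A B. {A, B} \<in> edges ?G) (\<phi> ` proper_words n) (\<phi> u) (\<phi> v)"
      by (rule ham_map[OF ham_proper_words[OF assms uv(1,2,5)] inj]) (rule adj_edge)
    then show "\<exists>p. hamiltonian_path ?G A B p"
      unfolding hamiltonian_path_def ham_def V uv(3,4) .
  qed
qed

end
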